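(* Let $E$ be a separable Banach space over $\mathbb{K}\in\{\mathbb{R},\mathbb{C}\}$. 1. If $E$ has a Schauder frame, then there exists a Banach space $Z$ such that $Z$ has a Schauder basis and $E$ is isometrically isomorphic to a complemented subspace of $Z$. 2. If $E$ is isomorphic to a complemented subspace of a Banach space $Z$ which has a Schauder basis, then $E$ has a Schauder frame.
   Context: All Banach spaces are over the same field $\mathbb{K}$. Let $X$ be a Banach space with dual $X^*$, and let $\mathbb{I}$ be either $\mathbb{N}^*=\{1,2,3,\dots\}$ or $\{1,\dots,r\}$ for some $r\in\mathbb{N}^*$. A Schauder frame of $X$ is a sequence $((x_n,y_n^* ))_{n\in\mathbb{I}}$ of elements of $X\times X^*$ such that for every $x\in X$ one has $\sum_{n\in\mathbb{I}} y_n^*(x)x_n=x$ (when $\mathbb{I}=\mathbb{N}^*$: the series $\sum y_n^*(x)x_n$ converges in the norm of $X$ to $x$). A subspace of a Banach space is complemented if it is the range of a bounded linear projection (in particular it is closed). In a finite-dimensional space an algebraic basis counts as a Schauder basis. "Isomorphic" means linearly homeomorphic. *)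

theory Defs
  imports "HOL-Analysis.Analysis" "HOL-Library.Function_Algebras"
begin

text \<open>
  Banach spaces over a field of scalars \<open>'k\<close> (used with \<open>real\<close> and \<open>complex\<close>) are given by a carrier
  inside an ambient vector space on a type of class \<^class>\<open>ab_group_add\<close>, together with a norm which
  is only constrained on the carrier. The carrier and the norm are data, so that one can assert the
  existence of a Banach space. Addition is that of the ambient type; on \<open>nat \<Rightarrow> 'k\<close> it is pointwise
  (\<^theory>\<open>HOL-Library.Function_Algebras\<close>).
\<close>

record ('k, 'v) nvs =
  vs_scale :: "'k \<Rightarrow> 'v \<Rightarrow> 'v"
  vs_carrier :: "'v set"
  vs_norm :: "'v \<Rightarrow> real"

definition normed_space :: "('k::real_normed_field, 'v::ab_group_add) nvs \<Rightarrow> bool" where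
  "normed_space X \<longleftrightarrow>
     vector_space (vs_scale X) \<and>
     module.subspace (vs_scale X) (vs_carrier X) \<and>
     (\<forall>x\<in>vs_carrier X. 0 \<le> vs_norm X x) \<and>
     (\<forall>x\<in>vs_carrier X. vs_norm X x = 0 \<longleftrightarrow> x = 0) \<and>
     (\<forall>a. \<forall>x\<in>vs_carrier X. vs_norm X (vs_scale X a x) = norm a * vs_norm X x) \<and>
     (\<forall>x\<in>vs_carrier X. \<forall>y\<in>vs_carrier X. vs_norm X (x + y) \<le> vs_norm X x + vs_norm X y)"

text \<open>The value 0 off the carrier is there because the locale \<^locale>\<open>Metric_space\<close> demands
  nonnegativity and symmetry of the distance on the whole type.\<close>

definition vs_dist :: "('k, 'v::ab_group_add) nvs \<Rightarrow> 'v \<Rightarrow> 'v \<Rightarrow> real" where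
  "vs_dist X x y = (if x \<in> vs_carrier X \<and> y \<in> vs_carrier X then vs_norm X (x - y) else 0)"

definition vs_topology :: "('k, 'v::ab_group_add) nvs \<Rightarrow> 'v topology" where
  "vs_topology X = Metric_space.mtopology (vs_carrier X) (vs_dist X)"

definition banach_space :: "('k::real_normed_field, 'v::ab_group_add) nvs \<Rightarrow> bool" where
  "banach_space X \<longleftrightarrow>
     normed_space X \<and> Metric_space.mcomplete (vs_carrier X) (vs_dist X)"

definition linear_subspace :: "('k, 'v) nvs \<Rightarrow> 'v set \<Rightarrow> ('k, 'v) nvs" where
  "linear_subspace X F = X\<lparr>vs_carrier := F\<rparr>"

definition scalar_space :: "('k::real_normed_field, 'k) nvs" where
  "scalar_space = \<lparr>vs_scale = (*), vs_carrier = UNIV, vs_norm = norm\<rparr>"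

definition linear_map ::
  "('k, 'v::ab_group_add) nvs \<Rightarrow> ('k, 'w::ab_group_add) nvs \<Rightarrow> ('v \<Rightarrow> 'w) \<Rightarrow> bool" where
  "linear_map X Y T \<longleftrightarrow>
     T ` vs_carrier X \<subseteq> vs_carrier Y \<and>
     (\<forall>x\<in>vs_carrier X. \<forall>y\<in>vs_carrier X. T (x + y) = T x + T y) \<and>
     (\<forall>a. \<forall>x\<in>vs_carrier X. T (vs_scale X a x) = vs_scale Y a (T x))"

definition bounded_linear_map ::
  "('k, 'v::ab_group_add) nvs \<Rightarrow> ('k, 'w::ab_group_add) nvs \<Rightarrow> ('v \<Rightarrow> 'w) \<Rightarrow> bool" where
  "bounded_linear_map X Y T \<longleftrightarrow>
     linear_map X Y T \<and> (\<exists>C. \<forall>x\<in>vs_carrier X. vs_norm Y (T x) \<le> C * vs_norm X x)"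

definition dual :: "('k::real_normed_field, 'v::ab_group_add) nvs \<Rightarrow> ('v \<Rightarrow> 'k) set" where
  "dual X = {f. bounded_linear_map X scalar_space f}"

definition isomorphic ::
  "('k, 'v::ab_group_add) nvs \<Rightarrow> ('k, 'w::ab_group_add) nvs \<Rightarrow> bool" where
  "isomorphic X Y \<longleftrightarrow>
     (\<exists>T. linear_map X Y T \<and> homeomorphic_map (vs_topology X) (vs_topology Y) T)"

definition isometrically_isomorphic ::
  "('k, 'v::ab_group_add) nvs \<Rightarrow> ('k, 'w::ab_group_add) nvs \<Rightarrow> bool" where
  "isometrically_isomorphic X Y \<longleftrightarrow>
     (\<exists>T. linear_map X Y T \<and> bij_betw T (vs_carrier X) (vs_carrier Y) \<and>
          (\<forall>x\<in>vs_carrier X. vs_norm Y (T x) = vs_norm X x))"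

definition complemented :: "('k, 'v::ab_group_add) nvs \<Rightarrow> 'v set \<Rightarrow> bool" where
  "complemented X F \<longleftrightarrow>
     (\<exists>P. bounded_linear_map X X P \<and> (\<forall>x\<in>vs_carrier X. P (P x) = P x) \<and> P ` vs_carrier X = F)"

definition index_set :: "nat set \<Rightarrow> bool" where
  "index_set I \<longleftrightarrow> I = {1..} \<or> (\<exists>r\<ge>1. I = {1..r})"

text \<open>For finite \<open>I\<close> the partial sums are eventually constant, so this is the finite sum.\<close>

definition sums_on :: "('k, 'v::ab_group_add) nvs \<Rightarrow> nat set \<Rightarrow> (nat \<Rightarrow> 'v) \<Rightarrow> 'v \<Rightarrow> bool" where
  "sums_on X I f s \<longleftrightarrow>
     limitin (vs_topology X) (\<lambda>N. \<Sum>n\<in>{n\<in>I. n \<le> N}. f n) s sequentially"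

definition schauder_frame ::
  "('k::real_normed_field, 'v::ab_group_add) nvs \<Rightarrow> nat set \<Rightarrow> (nat \<Rightarrow> 'v) \<Rightarrow> (nat \<Rightarrow> 'v \<Rightarrow> 'k) \<Rightarrow> bool"
  where
  "schauder_frame X I x y \<longleftrightarrow>
     index_set I \<and> (\<forall>n\<in>I. x n \<in> vs_carrier X \<and> y n \<in> dual X) \<and>
     (\<forall>v\<in>vs_carrier X. sums_on X I (\<lambda>n. vs_scale X (y n v) (x n)) v)"

definition has_schauder_frame :: "('k::real_normed_field, 'v::ab_group_add) nvs \<Rightarrow> bool" where
  "has_schauder_frame X \<longleftrightarrow> (\<exists>I x y. schauder_frame X I x y)"

text \<open>\<^const>\<open>extensional\<close> only makes the coefficient sequence, indexed from 1, unique as a function on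
  \<^typ>\<open>nat\<close>.\<close>

definition schauder_basis_seq :: "('k, 'v::ab_group_add) nvs \<Rightarrow> (nat \<Rightarrow> 'v) \<Rightarrow> bool" where
  "schauder_basis_seq X e \<longleftrightarrow>
     (\<forall>n\<ge>1. e n \<in> vs_carrier X) \<and>
     (\<forall>v\<in>vs_carrier X. \<exists>!a. a \<in> extensional {1..} \<and> sums_on X {1..} (\<lambda>n. vs_scale X (a n) (e n)) v)"

text \<open>The second alternative is a finite algebraic basis (empty for the zero space).\<close>

definition has_schauder_basis :: "('k::real_normed_field, 'v::ab_group_add) nvs \<Rightarrow> bool" where
  "has_schauder_basis X \<longleftrightarrow>
     (\<exists>e. schauder_basis_seq X e) \<or>
     (\<exists>B. finite B \<and> B \<subseteq> vs_carrier X \<and> \<not> module.dependent (vs_scale X) B \<and>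
          module.span (vs_scale X) B = vs_carrier X)"

lemma normed_space_Metric_space:
  assumes "normed_space X"
  shows "Metric_space (vs_carrier X) (vs_dist X)"
proof -
  interpret vector_space "vs_scale X"
    using assms by (simp add: normed_space_def)
  have S: "subspace (vs_carrier X)"
    using assms by (simp add: normed_space_def)
  have D: "x - y \<in> vs_carrier X" if "x \<in> vs_carrier X" "y \<in> vs_carrier X" for x y
    using subspace_diff[OF S] that by blast
  have N: "\<forall>a. \<forall>x\<in>vs_carrier X. vs_norm X (vs_scale X a x) = norm a * vs_norm X x"
    "\<forall>x\<in>vs_carrier X. 0 \<le> vs_norm X x" "\<forall>x\<in>vs_carrier X. vs_norm X x = 0 \<longleftrightarrow> x = 0"
    "\<forall>x\<in>vs_carrier X. \<forall>y\<in>vs_carrier X. vs_norm X (x + y) \<le> vs_norm X x + vs_norm X y"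
    using assms by (auto simp: normed_space_def)
  have M: "vs_norm X (y - x) = vs_norm X (x - y)" if "x \<in> vs_carrier X" "y \<in> vs_carrier X" for x y
    using N(1)[rule_format, OF D[OF that], of "- 1"] by simp
  show ?thesis
  proof
    fix x y z
    show "0 \<le> vs_dist X x y" using N(2) D by (simp add: vs_dist_def)
    show "vs_dist X x y = vs_dist X y x" using M by (simp add: vs_dist_def)
    show "vs_dist X x y = 0 \<longleftrightarrow> x = y" if "x \<in> vs_carrier X" "y \<in> vs_carrier X"
      using that N(3) D by (simp add: vs_dist_def)
    show "vs_dist X x z \<le> vs_dist X x y + vs_dist X y z"
      if "x \<in> vs_carrier X" "y \<in> vs_carrier X" "z \<in> vs_carrier X"
      using that N(4)[rule_format, of "x - y" "y - z"] D by (simp add: vs_dist_def)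
  qed
qed

lemma vs_dist_UNIV:
  "vs_dist \<lparr>vs_scale = s, vs_carrier = UNIV, vs_norm = norm\<rparr> = (dist :: 'a::real_normed_vector \<Rightarrow> _)"
  by (auto simp: vs_dist_def dist_norm fun_eq_iff)

lemma banach_space_UNIV:
  assumes "vector_space s" "\<And>a x. norm (s a x) = norm a * norm x"
  shows "banach_space \<lparr>vs_scale = s, vs_carrier = UNIV, vs_norm = (norm :: 'a::banach \<Rightarrow> real)\<rparr>"
proof -
  interpret S: vector_space s by fact
  show ?thesis
    unfolding banach_space_def normed_space_def vs_dist_UNIV
    using assms by (auto simp: norm_triangle_ineq S.subspace_UNIV complete_UNIV)
qed

lemma banach_space_scaleR:
  "banach_space \<lparr>vs_scale = (*\<^sub>R), vs_carrier = UNIV, vs_norm = (norm :: 'a::banach \<Rightarrow> real)\<rparr>"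
  by (rule banach_space_UNIV) (unfold_locales, auto simp: algebra_simps)

lemma banach_space_scalar_space:
  "banach_space (scalar_space :: ('k::{real_normed_field,banach}, 'k) nvs)"
  unfolding scalar_space_def
  by (rule banach_space_UNIV) (unfold_locales, auto simp: algebra_simps norm_mult)

end

theory Submission
  imports Defs
begin

text \<open>
  If \<open>E\<close> is complemented in a space with a basis, then the image of the basis under the projection
  is a frame. What needs proof is that the coefficient functionals of a basis are bounded.

  Conversely, let \<open>(x n, y n)\<close> be a frame of \<open>E\<close>. All scalar sequences \<open>a\<close> for which the series of
  the \<open>a n * x n\<close> converges form a Banach space \<open>Z\<close> under the supremum of the norms of the partial
  sums, provided that no \<open>x n\<close> is 0; unless \<open>E\<close> is trivial, this is arranged by replacing such \<open>x n\<close> by a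
  fixed nonzero vector and \<open>y n\<close> by 0. The unit vectors are a basis of \<open>Z\<close>. Summation of the series is a bounded map
  \<open>R\<close> from \<open>Z\<close> to \<open>E\<close>, and it has the right inverse \<open>J\<close> that maps \<open>v\<close> to the sequence of the
  \<open>y n v\<close>. Hence \<open>J \<circ> R\<close> projects \<open>Z\<close> onto a copy of \<open>E\<close>, if only \<open>J\<close> is bounded. The norm of
  \<open>R a\<close> plus the norm of \<open>a - J (R a)\<close> is an equivalent norm on \<open>Z\<close> that makes \<open>J\<close> isometric.

  Both boundedness claims say that the supremum of the norms of the partial sums of the expansion
  of \<open>v\<close> is at most a constant times the norm of \<open>v\<close>. This supremum is a seminorm of \<open>v\<close>, and it is
  countably subadditive: for a frame because the partial sum operators are continuous
  (\<open>snorm_coef_bounded_if_dual\<close>), for a basis because expansions are unique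
  (\<open>snorm_coef_bounded\<close>). By Zabreiko's lemma (\<open>countably_subadditive_seminorm_bounded\<close>), which
  follows from the Baire category theorem, such a seminorm on a Banach space is bounded.
\<close>

section \<open>Norm convergence\<close>

text \<open>All limits below are taken of sequences that stay in the carrier. For these, convergence in
  \<^const>\<open>vs_topology\<close> is the convergence to 0 of a real sequence, which the limit theorems on the
  reals can handle.\<close>

definition norm_lim :: "('k, 'v::ab_group_add) nvs \<Rightarrow> (nat \<Rightarrow> 'v) \<Rightarrow> 'v \<Rightarrow> bool" where
  "norm_lim X f s \<longleftrightarrow>
     range f \<subseteq> vs_carrier X \<and> s \<in> vs_carrier X \<and> (\<lambda>n. vs_norm X (f n - s)) \<longlonglongrightarrow> 0"

definition norm_Cauchy :: "('k, 'v::ab_group_add) nvs \<Rightarrow> (nat \<Rightarrow> 'v) \<Rightarrow> bool" where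
  "norm_Cauchy X f \<longleftrightarrow> range f \<subseteq> vs_carrier X \<and>
     (\<forall>e>0. \<exists>K. \<forall>m\<ge>K. \<forall>n\<ge>K. vs_norm X (f m - f n) < e)"

locale normed_space_on =
  fixes X :: "('k::real_normed_field, 'v::ab_group_add) nvs"
  assumes normed: "normed_space X"
begin

abbreviation "carr \<equiv> vs_carrier X"
abbreviation "nrm \<equiv> vs_norm X"
abbreviation "sc \<equiv> vs_scale X"

sublocale vs: vector_space "vs_scale X"
  using normed by (simp add: normed_space_def)

sublocale ms: Metric_space "vs_carrier X" "vs_dist X"
  by (rule normed_space_Metric_space[OF normed])

lemma subspace_carr: "vs.subspace carr"
  using normed by (simp add: normed_space_def)

lemma zero_mem [simp]: "0 \<in> carr"
  using vs.subspace_0 subspace_carr by blast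
lemma add_mem [simp]: "u \<in> carr \<Longrightarrow> v \<in> carr \<Longrightarrow> u + v \<in> carr"
  using vs.subspace_add subspace_carr by blast
lemma diff_mem [simp]: "u \<in> carr \<Longrightarrow> v \<in> carr \<Longrightarrow> u - v \<in> carr"
  using vs.subspace_diff subspace_carr by blast
lemma scale_mem [simp]: "u \<in> carr \<Longrightarrow> sc c u \<in> carr"
  using vs.subspace_scale subspace_carr by blast
lemma sum_mem [simp]: "(\<And>i. i \<in> A \<Longrightarrow> f i \<in> carr) \<Longrightarrow> sum f A \<in> carr"
  using vs.subspace_sum subspace_carr by blast

lemma norm_nonneg [simp]: "u \<in> carr \<Longrightarrow> 0 \<le> nrm u"
  using normed by (simp add: normed_space_def)
lemma norm_eq_0 [simp]: "u \<in> carr \<Longrightarrow> nrm u = 0 \<longleftrightarrow> u = 0"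
  using normed by (simp add: normed_space_def)
lemma norm_pos: "u \<in> carr \<Longrightarrow> u \<noteq> 0 \<Longrightarrow> 0 < nrm u"
  by (simp add: order_less_le)
lemma norm_zero [simp]: "nrm 0 = 0"
  by simp
lemma norm_scale [simp]: "u \<in> carr \<Longrightarrow> nrm (sc c u) = norm c * nrm u"
  using normed by (simp add: normed_space_def)
lemma norm_triangle: "u \<in> carr \<Longrightarrow> v \<in> carr \<Longrightarrow> nrm (u + v) \<le> nrm u + nrm v"
  using normed by (simp add: normed_space_def)
lemma norm_commute: "u \<in> carr \<Longrightarrow> v \<in> carr \<Longrightarrow> nrm (u - v) = nrm (v - u)"
  using norm_scale[of "v - u" "-1"] by simp
lemma norm_minus [simp]: "u \<in> carr \<Longrightarrow> nrm (- u) = nrm u"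
  using norm_commute[of 0 u] by simp
lemma norm_diff_le: "u \<in> carr \<Longrightarrow> v \<in> carr \<Longrightarrow> nrm (u - v) \<le> nrm u + nrm v"
  using norm_triangle[of u "- v"] norm_minus[of v] diff_mem[of 0 v] by simp
lemma norm_triangle_sub: "u \<in> carr \<Longrightarrow> v \<in> carr \<Longrightarrow> nrm u \<le> nrm (u - v) + nrm v"
  using norm_triangle[of "u - v" v] by simp
lemma norm_diff_triangle:
  "u \<in> carr \<Longrightarrow> v \<in> carr \<Longrightarrow> w \<in> carr \<Longrightarrow> nrm (u - w) \<le> nrm (u - v) + nrm (v - w)"
  using norm_triangle[of "u - v" "v - w"] by simp
lemma norm_sum_le: "(\<And>i. i \<in> A \<Longrightarrow> f i \<in> carr) \<Longrightarrow> nrm (sum f A) \<le> (\<Sum>i\<in>A. nrm (f i))"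
proof (induction A rule: infinite_finite_induct)
  case (insert a A)
  then show ?case using norm_triangle[of "f a" "sum f A"] by fastforce
qed auto

lemma limitin_iff_norm_lim:
  assumes "range f \<subseteq> carr"
  shows "limitin (vs_topology X) f s sequentially \<longleftrightarrow> norm_lim X f s"
proof -
  have "(\<lambda>n. nrm (f n - s)) \<longlonglongrightarrow> 0 \<longleftrightarrow> (\<forall>e>0. eventually (\<lambda>n. nrm (f n - s) < e) sequentially)"
    if "s \<in> carr"
    using assms that by (auto simp: tendsto_iff dist_norm image_subset_iff)
  then show ?thesis
    using assms unfolding vs_topology_def ms.limitin_metric norm_lim_def
    by (auto simp: vs_dist_def image_subset_iff)
qed

lemma sums_on_iff:
  assumes "\<And>n. n \<ge> 1 \<Longrightarrow> f n \<in> carr"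
  shows "sums_on X {1..} f s \<longleftrightarrow> norm_lim X (\<lambda>N. \<Sum>n<N. f (Suc n)) s"
proof -
  have "(\<Sum>n\<in>{n\<in>{1..}. n \<le> N}. f n) = (\<Sum>n<N. f (Suc n))" for N
    by (rule sum.reindex_bij_witness[of _ Suc "\<lambda>n. n - 1"]) auto
  then show ?thesis
    unfolding sums_on_def using limitin_iff_norm_lim[of "\<lambda>N. \<Sum>n<N. f (Suc n)" s] assms
    by (simp add: image_subset_iff)
qed

lemma norm_lim_mem: "norm_lim X f s \<Longrightarrow> f n \<in> carr" "norm_lim X f s \<Longrightarrow> s \<in> carr"
  by (auto simp: norm_lim_def)

lemma norm_limI:
  assumes "\<And>n. f n \<in> carr" "s \<in> carr" "g \<longlonglongrightarrow> 0"
    "eventually (\<lambda>n. nrm (f n - s) \<le> g n) sequentially"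
  shows "norm_lim X f s"
  using assms unfolding norm_lim_def
  by (auto intro!: tendsto_sandwich[OF _ _ tendsto_const assms(3)])

lemma norm_lim_add:
  assumes "norm_lim X f s" "norm_lim X g t"
  shows "norm_lim X (\<lambda>n. f n + g n) (s + t)"
proof (rule norm_limI)
  show "(\<lambda>n. nrm (f n - s) + nrm (g n - t)) \<longlonglongrightarrow> 0"
    using assms tendsto_add[of _ 0 sequentially _ 0] by (auto simp: norm_lim_def)
  show "\<forall>\<^sub>F n in sequentially. nrm (f n + g n - (s + t)) \<le> nrm (f n - s) + nrm (g n - t)"
    using norm_triangle[of "f _ - s" "g _ - t"] norm_lim_mem[OF assms(1)] norm_lim_mem[OF assms(2)]
    by (auto simp: algebra_simps)
qed (use assms norm_lim_mem in auto)

lemma norm_lim_scale: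
  assumes "norm_lim X f s"
  shows "norm_lim X (\<lambda>n. sc c (f n)) (sc c s)"
proof (rule norm_limI)
  show "(\<lambda>n. norm c * nrm (f n - s)) \<longlonglongrightarrow> 0"
    using assms tendsto_mult_left[of _ 0 sequentially "norm c"] by (auto simp: norm_lim_def)
  show "\<forall>\<^sub>F n in sequentially. nrm (sc c (f n) - sc c s) \<le> norm c * nrm (f n - s)"
    using norm_lim_mem[OF assms]
    by (simp add: vs.scale_right_diff_distrib[symmetric])
qed (use assms norm_lim_mem in auto)

lemma norm_lim_diff:
  assumes "norm_lim X f s" "norm_lim X g t"
  shows "norm_lim X (\<lambda>n. f n - g n) (s - t)"
  using norm_lim_add[OF assms(1) norm_lim_scale[OF assms(2), of "-1"]] by simp

lemma norm_lim_const: "s \<in> carr \<Longrightarrow> norm_lim X (\<lambda>_. s) s"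
  by (simp add: norm_lim_def)

lemma norm_lim_sum:
  assumes "\<And>i. i \<in> A \<Longrightarrow> norm_lim X (\<lambda>n. f i n) (s i)"
  shows "norm_lim X (\<lambda>n. \<Sum>i\<in>A. f i n) (\<Sum>i\<in>A. s i)"
  using assms
  by (induction A rule: infinite_finite_induct) (auto intro: norm_lim_add norm_lim_const)

lemma norm_lim_tendsto_norm:
  assumes "norm_lim X f s"
  shows "(\<lambda>n. nrm (f n)) \<longlonglongrightarrow> nrm s"
proof (rule Lim_transform2[OF tendsto_const], rule tendsto_sandwich)
  note m = norm_lim_mem[OF assms]
  show "\<forall>\<^sub>F n in sequentially. - nrm (f n - s) \<le> nrm s - nrm (f n)"
    using norm_triangle_sub[of "f _" s] m by (auto simp: algebra_simps)
  show "\<forall>\<^sub>F n in sequentially. nrm s - nrm (f n) \<le> nrm (f n - s)"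
    using norm_triangle_sub[of s "f _"] norm_commute[of s] m by (auto simp: algebra_simps)
  show "(\<lambda>n. nrm (f n - s)) \<longlonglongrightarrow> 0" "(\<lambda>n. - nrm (f n - s)) \<longlonglongrightarrow> 0"
    using assms tendsto_minus_cancel_left[of "\<lambda>n. nrm (f n - s)" 0] by (auto simp: norm_lim_def)
qed

lemma norm_lim_le:
  assumes "norm_lim X f s" "eventually (\<lambda>n. nrm (f n) \<le> B) sequentially"
  shows "nrm s \<le> B"
  using tendsto_upperbound[OF norm_lim_tendsto_norm[OF assms(1)] assms(2)] by simp

lemma norm_lim_unique:
  assumes "norm_lim X f s" "norm_lim X f t"
  shows "s = t"
proof -
  have "nrm (s - t) \<le> 0"
    using norm_lim_le[OF norm_lim_diff[OF assms], of 0] by simp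
  then show ?thesis
    using norm_eq_0[of "s - t"] norm_nonneg[of "s - t"] assms norm_lim_mem by fastforce
qed

text \<open>Convergence of each coefficient suffices, as the sum is finite and the vectors stay fixed.\<close>

lemma norm_lim_scale_sum:
  assumes "\<And>n. x n \<in> carr" "\<And>n. n \<in> A \<Longrightarrow> (\<lambda>m. c m n) \<longlonglongrightarrow> b n"
  shows "norm_lim X (\<lambda>m. \<Sum>n\<in>A. sc (c m n) (x n)) (\<Sum>n\<in>A. sc (b n) (x n))"
proof (rule norm_limI)
  have "(\<lambda>m. \<Sum>n\<in>A. norm (c m n - b n) * nrm (x n)) \<longlonglongrightarrow> (\<Sum>n\<in>A. 0 * nrm (x n))"
    using assms(2) by (intro tendsto_intros tendsto_norm_zero) (simp add: LIM_zero)
  then show "(\<lambda>m. \<Sum>n\<in>A. norm (c m n - b n) * nrm (x n)) \<longlonglongrightarrow> 0" by simp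
  have "nrm ((\<Sum>n\<in>A. sc (c m n) (x n)) - (\<Sum>n\<in>A. sc (b n) (x n)))
      \<le> (\<Sum>n\<in>A. norm (c m n - b n) * nrm (x n))" for m
    using norm_sum_le[of A "\<lambda>n. sc (c m n - b n) (x n)"] assms(1)
    by (simp add: sum_subtractf[symmetric] vs.scale_left_diff_distrib[symmetric])
  then show "\<forall>\<^sub>F m in sequentially. nrm ((\<Sum>n\<in>A. sc (c m n) (x n)) - (\<Sum>n\<in>A. sc (b n) (x n)))
      \<le> (\<Sum>n\<in>A. norm (c m n - b n) * nrm (x n))" by simp
qed (use assms in auto)

lemma norm_Cauchy_eq_MCauchy: "norm_Cauchy X f \<longleftrightarrow> ms.MCauchy f"
  by (auto simp: norm_Cauchy_def ms.MCauchy_def vs_dist_def image_subset_iff)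

lemma norm_lim_imp_norm_Cauchy:
  assumes "norm_lim X f s" shows "norm_Cauchy X f"
  using assms ms.convergent_imp_MCauchy limitin_iff_norm_lim
  by (auto simp: norm_Cauchy_eq_MCauchy norm_lim_def vs_topology_def)

lemma banach_space_iff: "banach_space X \<longleftrightarrow> (\<forall>f. norm_Cauchy X f \<longrightarrow> (\<exists>s. norm_lim X f s))"
proof -
  have "limitin ms.mtopology f s sequentially \<longleftrightarrow> norm_lim X f s" if "norm_Cauchy X f" for f s
    using limitin_iff_norm_lim[of f s] that by (simp add: norm_Cauchy_def vs_topology_def)
  then show ?thesis
    using normed by (auto simp: banach_space_def ms.mcomplete_def norm_Cauchy_eq_MCauchy)
qed

end

section \<open>Countably subadditive seminorms on a Banach space\<close>

locale banach_space_on =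
  fixes X :: "('k::real_normed_field, 'v::ab_group_add) nvs"
  assumes banach: "banach_space X"

sublocale banach_space_on \<subseteq> normed_space_on
  using banach by unfold_locales (simp add: banach_space_def)

context banach_space_on
begin

lemma norm_Cauchy_lim: "norm_Cauchy X f \<Longrightarrow> \<exists>s. norm_lim X f s"
  using banach banach_space_iff by blast

text \<open>Zabreiko's lemma, which plays the role of both the uniform boundedness principle and the open
  mapping theorem. By the Baire category theorem, the closure of some set \<open>{v. p v \<le> n}\<close> has an interior
  point, and by symmetry of the sets this closure is, up to a factor 2, a neighbourhood of 0. As in
  the proof of the open mapping theorem, a small \<open>w\<close> is then the sum of a series of vectors whose
  \<open>p\<close>-values are bounded by a geometric sequence, and countable subadditivity turns this into a bound on \<open>p w\<close>.\<close>

lemma countably_subadditive_seminorm_bounded: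
  fixes p :: "'v \<Rightarrow> real"
  assumes nonneg: "\<And>v. v \<in> carr \<Longrightarrow> 0 \<le> p v"
    and scale: "\<And>c v. v \<in> carr \<Longrightarrow> p (sc c v) = norm c * p v"
    and add: "\<And>u v. u \<in> carr \<Longrightarrow> v \<in> carr \<Longrightarrow> p (u + v) \<le> p u + p v"
    and csub: "\<And>f s. norm_lim X (\<lambda>N. \<Sum>n<N. f n) s \<Longrightarrow> range f \<subseteq> carr \<Longrightarrow> summable (\<lambda>n. p (f n))
        \<Longrightarrow> p s \<le> (\<Sum>n. p (f n))"
  obtains K where "K \<ge> 0" "\<And>v. v \<in> carr \<Longrightarrow> p v \<le> K * nrm v"
proof -
  let ?T = ms.mtopology
  define A where "A n = {v \<in> carr. p v \<le> real n}" for n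
  have "\<exists>n. ?T interior_of (?T closure_of A n) \<noteq> {}"
  proof (rule ccontr)
    assume "\<nexists>n. ?T interior_of (?T closure_of A n) \<noteq> {}"
    then have "?T interior_of \<Union> (range (\<lambda>n. ?T closure_of A n)) = {}"
      using banach by (intro ms.metric_Baire_category_alt) (auto simp: banach_space_def)
    moreover have "\<Union> (range (\<lambda>n. ?T closure_of A n)) = carr"
    proof
      show "\<Union> (range (\<lambda>n. ?T closure_of A n)) \<subseteq> carr"
        using closure_of_subset_topspace[of ?T] by auto
      show "carr \<subseteq> \<Union> (range (\<lambda>n. ?T closure_of A n))"
      proof
        fix v assume v: "v \<in> carr"
        obtain n where "p v \<le> real n" using real_arch_simple by blast
        then have "v \<in> A n" using v by (simp add: A_def)
        moreover have "A n \<subseteq> ?T closure_of A n"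
          by (rule closure_of_subset) (auto simp: A_def)
        ultimately show "v \<in> \<Union> (range (\<lambda>n. ?T closure_of A n))" by blast
      qed
    qed
    ultimately have "carr = {}"
      using interior_of_topspace[of ?T] by simp
    then show False using zero_mem by blast
  qed
  then obtain n x0 where x0: "x0 \<in> ?T interior_of (?T closure_of A n)" by blast
  then obtain r where r: "r > 0" "ms.mball x0 r \<subseteq> ?T closure_of A n" and x0c: "x0 \<in> carr"
    unfolding ms.metric_interior_of by auto
  have cl: "\<exists>z\<in>carr. p z \<le> n \<and> nrm (v - z) < e" if "v \<in> carr" "nrm (v - x0) < r" "e > 0" for v e
  proof -
    have "v \<in> ms.mball x0 r" using that x0c norm_commute by (simp add: vs_dist_def)
    then have "v \<in> ?T closure_of A n" using r by blast
    then obtain z where "z \<in> A n" "z \<in> ms.mball v e"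
      using \<open>e > 0\<close> by (auto simp: ms.metric_closure_of)
    then show ?thesis by (auto simp: A_def vs_dist_def)
  qed
  \<comment> \<open>By subtracting an approximation of the centre, the ball is moved to the origin.\<close>
  have approx0: "\<exists>z\<in>carr. p z \<le> 2 * n \<and> nrm (w - z) < e" if w: "w \<in> carr" "nrm w < r" "e > 0" for w e
  proof -
    obtain z1 where z1: "z1 \<in> carr" "p z1 \<le> n" "nrm (x0 + w - z1) < e / 2"
      using cl[of "x0 + w" "e / 2"] x0c w by auto
    obtain z0 where z0: "z0 \<in> carr" "p z0 \<le> n" "nrm (x0 - z0) < e / 2"
      using cl[of "x0" "e / 2"] x0c w r by auto
    have "p (z1 - z0) \<le> p z1 + p z0"
      using add[of z1 "- z0"] scale[of z0 "-1"] scale_mem[of z0 "-1"] z0 z1 by simp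
    moreover have "nrm (w - (z1 - z0)) \<le> nrm (x0 + w - z1) + nrm (x0 - z0)"
      using norm_diff_le[of "x0 + w - z1" "x0 - z0"] x0c w z0 z1 by (simp add: algebra_simps)
    ultimately show ?thesis
      using z0 z1 by (intro bexI[of _ "z1 - z0"]) auto
  qed
  \<comment> \<open>Homogeneity of \<open>p\<close> and of the norm carries the approximation over to balls of radius \<open>r * t\<close>.\<close>
  have approx: "\<exists>z\<in>carr. p z \<le> 2 * n * t \<and> nrm (w - z) < e"
    if w: "w \<in> carr" "nrm w < r * t" "e > 0" "t > 0" for w e and t :: real
  proof -
    have "nrm (sc (of_real (1 / t)) w) < r" using w by (simp add: field_simps norm_divide)
    then obtain z where z: "z \<in> carr" "p z \<le> 2 * n" "nrm (sc (of_real (1 / t)) w - z) < e / t"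
      using approx0[of "sc (of_real (1 / t)) w" "e / t"] w by auto
    have "w - sc (of_real t) z = sc (of_real t) (sc (of_real (1 / t)) w - z)"
      using w by (simp add: vs.scale_right_diff_distrib of_real_mult[symmetric] del: of_real_mult of_real_divide)
    then have "nrm (w - sc (of_real t) z) = t * nrm (sc (of_real (1 / t)) w - z)"
      using w z by simp
    also have "\<dots> < t * (e / t)" using z w by (intro mult_strict_left_mono) auto
    finally have "nrm (w - sc (of_real t) z) < e" using w by simp
    then show ?thesis
      using z w by (intro bexI[of _ "sc (of_real t) z"]) (auto simp: scale field_simps)
  qed
  then have "\<forall>k w. \<exists>z. w \<in> carr \<and> nrm w < r * (1/2)^k
      \<longrightarrow> z \<in> carr \<and> p z \<le> 2 * n * (1/2)^k \<and> nrm (w - z) < r * (1/2)^Suc k"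
    using r by (metis (no_types, lifting) mult_pos_pos zero_less_divide_1_iff zero_less_numeral zero_less_power)
  then obtain g where g: "\<And>k w. w \<in> carr \<Longrightarrow> nrm w < r * (1/2)^k
      \<Longrightarrow> g k w \<in> carr \<and> p (g k w) \<le> 2 * n * (1/2)^k \<and> nrm (w - g k w) < r * (1/2)^Suc k"
    by metis
  have small: "p w \<le> 4 * n" if w: "w \<in> carr" "nrm w < r" for w
  proof -
    \<comment> \<open>\<open>R k\<close> is what remains of \<open>w\<close> after subtracting the first \<open>k\<close> approximations.\<close>
    define R where "R = rec_nat w (\<lambda>k v. v - g k v)"
    have R0: "R 0 = w" and RS: "R (Suc k) = R k - g k (R k)" for k by (auto simp: R_def)
    have R: "R k \<in> carr \<and> nrm (R k) < r * (1/2)^k" for k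
      by (induction k) (use w g in \<open>auto simp: R0 RS\<close>)
    define z where "z k = g k (R k)" for k
    have z: "z k \<in> carr" "p (z k) \<le> 2 * n * (1/2)^k" for k using g R by (auto simp: z_def)
    have "(\<Sum>k<N. z k) = w - R N" for N
      by (induction N) (auto simp: R0 RS z_def)
    then have lim: "norm_lim X (\<lambda>N. \<Sum>k<N. z k) w"
    proof (intro norm_limI)
      show "(\<lambda>k. r * (1/2)^k) \<longlonglongrightarrow> 0"
        using tendsto_mult_right_zero[OF LIMSEQ_power_zero[of "1/2::real"]] by simp
    qed (use R w z in \<open>auto simp: less_imp_le\<close>)
    have geo: "(\<lambda>k. 2 * n * (1/2)^k) sums (2 * n * 2)"
      using sums_mult[OF geometric_sums[of "1/2::real"], of "2 * n"] by simp
    have sm: "summable (\<lambda>k. p (z k))"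
      using z nonneg by (intro summable_comparison_test'[OF sums_summable[OF geo], of 0]) auto
    have "p w \<le> (\<Sum>k. p (z k))"
      using csub[OF lim] z sm by blast
    also have "\<dots> \<le> (\<Sum>k. 2 * n * (1/2)^k)"
      using z sm geo by (intro suminf_le sums_summable[OF geo]) auto
    finally show ?thesis using sums_unique[OF geo] by simp
  qed
  show thesis
  proof
    show "0 \<le> 4 * n * (2 / r)" using r by simp
    fix v assume v: "v \<in> carr"
    show "p v \<le> 4 * n * (2 / r) * nrm v"
    proof (cases "v = 0")
      case True
      then show ?thesis using scale[of 0 0] by simp
    next
      case False
      then have pos: "nrm v > 0" using v norm_nonneg[of v] norm_eq_0[of v] by linarith
      \<comment> \<open>The factor 2 brings the rescaled vector strictly inside the ball of radius \<open>r\<close>.\<close>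
      define t where "t = r / (2 * nrm v)"
      have t: "t > 0" using pos r by (simp add: t_def)
      have "t * nrm v < r" using pos r by (simp add: t_def)
      then have "nrm (sc (of_real t) v) < r" using v t by simp
      then have "t * p v \<le> 4 * n" using small[of "sc (of_real t) v"] v t by (simp add: scale)
      then show ?thesis using pos r by (simp add: t_def field_simps)
    qed
  qed
qed

end

section \<open>Sequences of coefficients\<close>

text \<open>The vectors \<open>x n\<close> are arbitrary here, so that the facts on partial sums serve frames, bases, and the
  construction of a new space alike.\<close>

locale synthesis = banach_space_on X
  for X :: "('k::{real_normed_field,banach}, 'v::ab_group_add) nvs" +
  fixes x :: "nat \<Rightarrow> 'v"
  assumes x_mem [simp]: "x n \<in> carr"
begin

definition psum :: "(nat \<Rightarrow> 'k) \<Rightarrow> nat \<Rightarrow> 'v" where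
  "psum a N = (\<Sum>n<N. sc (a n) (x n))"

definition coeffs :: "(nat \<Rightarrow> 'k) set" where
  "coeffs = {a. \<exists>s. norm_lim X (psum a) s}"

definition total :: "(nat \<Rightarrow> 'k) \<Rightarrow> 'v" where
  "total a = (THE s. norm_lim X (psum a) s)"

text \<open>On \<open>coeffs\<close> the partial sums converge, hence are bounded, and the supremum is a seminorm. Off
  \<open>coeffs\<close> it has no meaning.\<close>

definition snorm :: "(nat \<Rightarrow> 'k) \<Rightarrow> real" where
  "snorm a = (SUP N. nrm (psum a N))"

lemma psum_mem [simp]: "psum a N \<in> carr"
  by (simp add: psum_def)

lemma psum_Suc: "psum a (Suc N) = psum a N + sc (a N) (x N)"
  by (simp add: psum_def)

lemma psum_add: "psum (a + b) N = psum a N + psum b N"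
  by (simp add: psum_def vs.scale_left_distrib sum.distrib)

lemma psum_diff: "psum (a - b) N = psum a N - psum b N"
  by (simp add: psum_def vs.scale_left_diff_distrib sum_subtractf)

lemma psum_scale: "psum (\<lambda>n. c * a n) N = sc c (psum a N)"
  by (simp add: psum_def vs.scale_sum_right)

lemma total_eq: "norm_lim X (psum a) s \<Longrightarrow> total a = s"
  unfolding total_def using norm_lim_unique by blast

lemma total_lim: "a \<in> coeffs \<Longrightarrow> norm_lim X (psum a) (total a)"
  using total_eq by (auto simp: coeffs_def)

lemma coeffsI: "norm_lim X (psum a) s \<Longrightarrow> a \<in> coeffs"
  by (auto simp: coeffs_def)

lemma total_mem [simp]: "a \<in> coeffs \<Longrightarrow> total a \<in> carr"
  using total_lim norm_lim_mem by blast

lemma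
  assumes "a \<in> coeffs" "b \<in> coeffs"
  shows coeffs_add [simp]: "a + b \<in> coeffs" and total_add: "total (a + b) = total a + total b"
proof -
  have "norm_lim X (psum (a + b)) (total a + total b)"
    using norm_lim_add[OF assms[THEN total_lim]] by (simp add: psum_add[symmetric])
  then show "a + b \<in> coeffs" "total (a + b) = total a + total b"
    by (auto intro: coeffsI total_eq)
qed

lemma coeffs_diff [simp]:
  assumes "a \<in> coeffs" "b \<in> coeffs"
  shows "a - b \<in> coeffs"
proof -
  have "norm_lim X (psum (a - b)) (total a - total b)"
    using norm_lim_diff[OF assms[THEN total_lim]] by (simp add: psum_diff[symmetric])
  then show ?thesis by (rule coeffsI)
qed

lemma
  assumes "a \<in> coeffs"
  shows coeffs_scale [simp]: "(\<lambda>n. c * a n) \<in> coeffs"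
    and total_scale: "total (\<lambda>n. c * a n) = sc c (total a)"
proof -
  have "norm_lim X (psum (\<lambda>n. c * a n)) (sc c (total a))"
    using norm_lim_scale[OF total_lim[OF assms], of c] by (simp add: psum_scale[symmetric])
  then show "(\<lambda>n. c * a n) \<in> coeffs" "total (\<lambda>n. c * a n) = sc c (total a)"
    by (auto intro: coeffsI total_eq)
qed

lemma coeffs_zero [simp]: "0 \<in> coeffs"
  by (rule coeffsI[of _ 0]) (simp add: norm_lim_def psum_def)

lemma bdd_above_psum: "a \<in> coeffs \<Longrightarrow> bdd_above (range (\<lambda>N. nrm (psum a N)))"
  by (rule bounded_imp_bdd_above, rule convergent_imp_bounded,
      rule norm_lim_tendsto_norm, rule total_lim)

lemma psum_le_snorm: "a \<in> coeffs \<Longrightarrow> nrm (psum a N) \<le> snorm a"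
  unfolding snorm_def by (rule cSUP_upper[OF _ bdd_above_psum]) auto

lemma snorm_least: "(\<And>N. nrm (psum a N) \<le> B) \<Longrightarrow> snorm a \<le> B"
  unfolding snorm_def by (rule cSUP_least) auto

lemma snorm_nonneg [simp]: "a \<in> coeffs \<Longrightarrow> 0 \<le> snorm a"
  using psum_le_snorm[of a 0] by (simp add: psum_def)

lemma total_le_snorm: "a \<in> coeffs \<Longrightarrow> nrm (total a) \<le> snorm a"
  by (rule norm_lim_le[OF total_lim]) (auto simp: psum_le_snorm)

lemma snorm_add: "a \<in> coeffs \<Longrightarrow> b \<in> coeffs \<Longrightarrow> snorm (a + b) \<le> snorm a + snorm b"
  using psum_le_snorm[of a] psum_le_snorm[of b] norm_triangle[of "psum a _" "psum b _"]
  by (intro snorm_least) (simp add: psum_add, smt (verit, best))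

lemma snorm_scale:
  assumes "a \<in> coeffs" shows "snorm (\<lambda>n. c * a n) = norm c * snorm a"
proof -
  have le: "snorm (\<lambda>n. c * a n) \<le> norm c * snorm a" if "a \<in> coeffs" for c a
    using psum_le_snorm[OF that] by (intro snorm_least) (simp add: psum_scale mult_left_mono)
  show ?thesis
  proof (cases "c = 0")
    case True
    then show ?thesis using le[OF assms, of 0] snorm_nonneg[OF coeffs_scale[OF assms, of 0]] by simp
  next
    case False
    then have "snorm a \<le> norm (1 / c) * snorm (\<lambda>n. c * a n)"
      using le[of "\<lambda>n. c * a n" "1 / c"] assms by simp
    then show ?thesis using le[OF assms, of c] False by (simp add: norm_divide field_simps)
  qed
qed

text \<open>Each term is the difference of two partial sums, hence the factor 2.\<close>

lemma coeff_le_snorm: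
  assumes "a \<in> coeffs" shows "norm (a n) * nrm (x n) \<le> 2 * snorm a"
proof -
  have "norm (a n) * nrm (x n) = nrm (psum a (Suc n) - psum a n)" by (simp add: psum_Suc)
  also have "\<dots> \<le> nrm (psum a (Suc n)) + nrm (psum a n)" by (rule norm_diff_le) auto
  also have "\<dots> \<le> 2 * snorm a"
    using psum_le_snorm[OF assms, of n] psum_le_snorm[OF assms, of "Suc n"] by simp
  finally show ?thesis .
qed

end

section \<open>Expansions with bounded partial sums\<close>

text \<open>The common part of frames and bases. Continuity of the coefficient functionals belongs to the
  definition of a frame, but for a basis it is a conclusion.\<close>

locale expansion = synthesis X x
  for X :: "('k::{real_normed_field,banach}, 'v::ab_group_add) nvs" and x +
  fixes y :: "nat \<Rightarrow> 'v \<Rightarrow> 'k"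
  assumes y_add: "u \<in> carr \<Longrightarrow> v \<in> carr \<Longrightarrow> y n (u + v) = y n u + y n v"
    and y_scale: "v \<in> carr \<Longrightarrow> y n (sc c v) = c * y n v"
    and expand: "v \<in> carr \<Longrightarrow> norm_lim X (psum (\<lambda>n. y n v)) v"
begin

abbreviation coef :: "'v \<Rightarrow> nat \<Rightarrow> 'k" where
  "coef v \<equiv> \<lambda>n. y n v"

lemma coef_mem [simp]: "v \<in> carr \<Longrightarrow> coef v \<in> coeffs"
  using coeffsI expand by blast

lemma total_coef [simp]: "v \<in> carr \<Longrightarrow> total (coef v) = v"
  using total_eq expand by blast

lemma coef_add: "u \<in> carr \<Longrightarrow> v \<in> carr \<Longrightarrow> coef (u + v) = coef u + coef v"
  by (simp add: fun_eq_iff y_add)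

lemma coef_scale: "v \<in> carr \<Longrightarrow> coef (sc c v) = (\<lambda>n. c * coef v n)"
  by (simp add: fun_eq_iff y_scale)

lemma coef_diff: "u \<in> carr \<Longrightarrow> v \<in> carr \<Longrightarrow> coef (u - v) = coef u - coef v"
  using coef_add[of "u - v" v] by simp

text \<open>Once countable subadditivity is known, Zabreiko's lemma bounds all partial sum operators at once.
  Frames and bases differ only in how they satisfy this condition.\<close>

lemma snorm_coef_bounded_if:
  assumes "\<And>f s. norm_lim X (\<lambda>N. \<Sum>n<N. f n) s \<Longrightarrow> range f \<subseteq> carr
      \<Longrightarrow> summable (\<lambda>n. snorm (coef (f n))) \<Longrightarrow> snorm (coef s) \<le> (\<Sum>n. snorm (coef (f n)))"
  obtains K where "K \<ge> 0" "\<And>v. v \<in> carr \<Longrightarrow> snorm (coef v) \<le> K * nrm v"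
proof (rule countably_subadditive_seminorm_bounded[of "\<lambda>v. snorm (coef v)"])
  show "snorm (coef (sc c v)) = norm c * snorm (coef v)" if "v \<in> carr" for c v
    using that by (simp only: coef_scale snorm_scale coef_mem)
  show "snorm (coef (u + v)) \<le> snorm (coef u) + snorm (coef v)" if "u \<in> carr" "v \<in> carr" for u v
    using that by (simp only: coef_add snorm_add coef_mem)
qed (use assms in auto)

lemma mem_dual_iff: "y n \<in> dual X \<longleftrightarrow> (\<exists>C. \<forall>v\<in>carr. norm (y n v) \<le> C * nrm v)"
  by (auto simp: dual_def bounded_linear_map_def linear_map_def scalar_space_def y_add y_scale)

text \<open>For a frame, each partial sum operator is continuous and so can be applied to a series term by
  term. The supremum over these operators is then countably subadditive.\<close>

lemma snorm_coef_bounded_if_dual: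
  assumes "\<And>n. y n \<in> dual X"
  obtains K where "K \<ge> 0" "\<And>v. v \<in> carr \<Longrightarrow> snorm (coef v) \<le> K * nrm v"
proof (rule snorm_coef_bounded_if)
  fix f s
  assume lim: "norm_lim X (\<lambda>N. \<Sum>n<N. f n) s" and f: "range f \<subseteq> carr"
    and sm: "summable (\<lambda>n. snorm (coef (f n)))"
  have s: "s \<in> carr" and fm: "f k \<in> carr" for k using lim f norm_lim_mem by auto
  obtain C where C: "\<And>n v. v \<in> carr \<Longrightarrow> norm (y n v) \<le> C n * nrm v"
    using assms unfolding mem_dual_iff by metis
  show "snorm (coef s) \<le> (\<Sum>n. snorm (coef (f n)))"
  proof (rule snorm_least)
    fix N
    have *: "psum (coef (\<Sum>k<M. f k)) N = (\<Sum>k<M. psum (coef (f k)) N)" for M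
    proof (induction M)
      case 0
      then show ?case using y_scale[of 0 _ 0] by (simp add: psum_def)
    qed (use fm in \<open>simp add: coef_add psum_add\<close>)
    have "norm_lim X (\<lambda>M. psum (coef (\<Sum>k<M. f k)) N) (psum (coef s) N)"
      unfolding psum_def
    proof (rule norm_lim_scale_sum)
      fix n
      have "(\<lambda>M. norm (y n (\<Sum>k<M. f k) - y n s)) \<longlonglongrightarrow> 0"
      proof (rule tendsto_sandwich[OF _ _ tendsto_const])
        have "(\<lambda>M. C n * nrm ((\<Sum>k<M. f k) - s)) \<longlonglongrightarrow> C n * 0"
          using lim by (intro tendsto_intros) (simp add: norm_lim_def)
        then show "(\<lambda>M. C n * nrm ((\<Sum>k<M. f k) - s)) \<longlonglongrightarrow> 0" by simp
        have "norm (y n (\<Sum>k<M. f k) - y n s) \<le> C n * nrm ((\<Sum>k<M. f k) - s)" for M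
          using C[of "(\<Sum>k<M. f k) - s" n] coef_diff[of "\<Sum>k<M. f k" s] fm s
          by (simp add: fun_eq_iff)
        then show "\<forall>\<^sub>F M in sequentially.
            norm (y n (\<Sum>k<M. f k) - y n s) \<le> C n * nrm ((\<Sum>k<M. f k) - s)" by simp
      qed auto
      then show "(\<lambda>M. y n (\<Sum>k<M. f k)) \<longlonglongrightarrow> y n s"
        using LIM_zero_iff tendsto_norm_zero_iff by blast
    qed simp
    then show "nrm (psum (coef s) N) \<le> (\<Sum>n. snorm (coef (f n)))"
    proof (rule norm_lim_le, intro always_eventually allI)
      fix M
      have "nrm (psum (coef (\<Sum>k<M. f k)) N) \<le> (\<Sum>k<M. nrm (psum (coef (f k)) N))"
        unfolding * by (rule norm_sum_le) simp
      also have "\<dots> \<le> (\<Sum>k<M. snorm (coef (f k)))"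
        using fm by (intro sum_mono psum_le_snorm) simp
      also have "\<dots> \<le> (\<Sum>n. snorm (coef (f n)))"
        using fm by (intro sum_le_suminf sm) auto
      finally show "nrm (psum (coef (\<Sum>k<M. f k)) N) \<le> (\<Sum>n. snorm (coef (f n)))" .
    qed
  qed
qed (use that in blast)

end

text \<open>An infinite Schauder basis is the case where \<open>J\<close> is all of \<open>nat\<close>, a basis of \<open>r\<close> vectors the case
  where \<open>J\<close> is \<open>{..<r}\<close>. Restricting uniqueness to coefficients that vanish off \<open>J\<close> lets both be
  treated as sequences indexed by \<^typ>\<open>nat\<close>.\<close>

locale unique_expansion = synthesis X x
  for X :: "('k::{real_normed_field,banach}, 'v::ab_group_add) nvs" and x +
  fixes y :: "nat \<Rightarrow> 'v \<Rightarrow> 'k" and J :: "nat set"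
  assumes support: "v \<in> carr \<Longrightarrow> n \<notin> J \<Longrightarrow> y n v = 0"
    and expands: "v \<in> carr \<Longrightarrow> norm_lim X (psum (\<lambda>n. y n v)) v"
    and unique: "norm_lim X (psum b) v \<Longrightarrow> (\<And>n. n \<notin> J \<Longrightarrow> b n = 0) \<Longrightarrow> b n = y n v"

sublocale unique_expansion \<subseteq> expansion
proof
  fix u v n c assume u: "u \<in> carr"
  { assume v: "v \<in> carr"
    have "norm_lim X (psum ((\<lambda>n. y n u) + (\<lambda>n. y n v))) (u + v)"
      using norm_lim_add[OF expands expands, OF u v] by (simp add: psum_add[symmetric])
    then show "y n (u + v) = y n u + y n v"
      using unique[of "(\<lambda>n. y n u) + (\<lambda>n. y n v)" "u + v" n] support u v by simp }
  have "norm_lim X (psum (\<lambda>n. c * y n u)) (sc c u)"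
    using norm_lim_scale[OF expands, OF u] by (simp add: psum_scale[symmetric])
  then show "y n (sc c u) = c * y n u"
    using unique[of "\<lambda>n. c * y n u" "sc c u" n] support u by simp
qed (rule expands)

context unique_expansion
begin

text \<open>Otherwise the \<open>n\<close>-th unit vector would be a second expansion of 0.\<close>

lemma x_nonzero: "n \<in> J \<Longrightarrow> x n \<noteq> 0"
proof
  assume n: "n \<in> J" "x n = 0"
  define b :: "nat \<Rightarrow> 'k" where "b k = (if k = n then 1 else 0)" for k
  have "psum b N = 0" for N using n by (auto simp: psum_def b_def intro!: sum.neutral)
  then have "norm_lim X (psum b) 0" by (simp add: norm_lim_def)
  then have "b n = y n 0" by (rule unique) (use n in \<open>auto simp: b_def\<close>)
  then show False using y_scale[of 0 n 0] by (simp add: b_def)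
qed

text \<open>Here no continuity is available, and uniqueness replaces it. If \<open>s\<close> is the sum of the \<open>f k\<close> and the
  partial sum norms of the \<open>f k\<close> are summable, then the \<open>n\<close>-th coefficients of the \<open>f k\<close> form an
  absolutely convergent series with a sum \<open>b n\<close>. Cutting off the sum over
  \<open>k\<close> changes every partial sum of \<open>b\<close> by at most a tail of the summable norms, whatever its length,
  so the limits can be interchanged and \<open>b\<close> expands \<open>s\<close>. By uniqueness, \<open>b\<close>
  is the coefficient sequence of \<open>s\<close>.\<close>

lemma snorm_coef_bounded:
  obtains K where "K \<ge> 0" "\<And>v. v \<in> carr \<Longrightarrow> snorm (coef v) \<le> K * nrm v"
proof (rule snorm_coef_bounded_if)
  fix f s
  assume lim: "norm_lim X (\<lambda>N. \<Sum>n<N. f n) s" and f: "range f \<subseteq> carr"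
    and sm: "summable (\<lambda>n. snorm (coef (f n)))"
  have s: "s \<in> carr" and fm [simp]: "f k \<in> carr" for k using lim f norm_lim_mem by auto
  define q where "q k = snorm (coef (f k))" for k
  have q0 [simp]: "0 \<le> q k" for k by (simp add: q_def)
  have sq: "summable (\<lambda>k. q (k + K))" for K
    using sm by (simp add: q_def summable_iff_shift[of "\<lambda>n. snorm (coef (f n))"])
  have ysm: "summable (\<lambda>k. y n (f k))" for n
  proof (cases "n \<in> J")
    case True
    then have x: "nrm (x n) > 0"
      using x_nonzero norm_pos by simp
    have le: "norm (y n (f k)) \<le> 2 / nrm (x n) * q k" for k
      using coeff_le_snorm[of "coef (f k)" n] x by (simp add: q_def field_simps)
    have "summable (\<lambda>k. 2 / nrm (x n) * q k)"
      using sq[of 0] by (intro summable_mult) simp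
    then show ?thesis by (rule summable_comparison_test'[where N = 0]) (rule le)
  qed (simp add: support)
  define b where "b n = (\<Sum>k. y n (f k))" for n
  have tail: "nrm (psum b N - (\<Sum>k<K. psum (coef (f k)) N)) \<le> (\<Sum>k. q (k + K))" for N K
  proof (rule norm_lim_le[OF norm_lim_diff[OF _ norm_lim_const]])
    have "norm_lim X (\<lambda>M. psum (\<lambda>n. \<Sum>k<M. y n (f k)) N) (psum b N)"
      unfolding psum_def b_def using ysm by (intro norm_lim_scale_sum summable_LIMSEQ) auto
    moreover have "psum (\<lambda>n. \<Sum>k<M. y n (f k)) N = (\<Sum>k<M. psum (coef (f k)) N)" for M
      by (simp add: psum_def vs.scale_sum_left sum.swap[of _ "{..<M}"])
    ultimately show "norm_lim X (\<lambda>M. \<Sum>k<M. psum (coef (f k)) N) (psum b N)" by simp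
    have "nrm ((\<Sum>k<M. psum (coef (f k)) N) - (\<Sum>k<K. psum (coef (f k)) N)) \<le> (\<Sum>k. q (k + K))"
      if "M \<ge> K" for M
    proof -
      have "(\<Sum>k<M. psum (coef (f k)) N) - (\<Sum>k<K. psum (coef (f k)) N)
          = (\<Sum>k<M-K. psum (coef (f (k + K))) N)"
        using that sum_diff_nat_ivl[of 0 K M "\<lambda>k. psum (coef (f k)) N"]
          sum.shift_bounds_nat_ivl[of "\<lambda>k. psum (coef (f k)) N" 0 K "M - K"]
        by (simp add: atLeast0LessThan)
      also have "nrm \<dots> \<le> (\<Sum>k<M-K. nrm (psum (coef (f (k + K))) N))" by (rule norm_sum_le) simp
      also have "\<dots> \<le> (\<Sum>k<M-K. q (k + K))"
        unfolding q_def by (intro sum_mono psum_le_snorm) simp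
      also have "\<dots> \<le> (\<Sum>k. q (k + K))" by (intro sum_le_suminf sq) auto
      finally show ?thesis .
    qed
    then show "\<forall>\<^sub>F M in sequentially.
        nrm ((\<Sum>k<M. psum (coef (f k)) N) - (\<Sum>k<K. psum (coef (f k)) N)) \<le> (\<Sum>k. q (k + K))"
      by (auto simp: eventually_sequentially)
  qed simp
  \<comment> \<open>Compare \<open>psum b N\<close> with \<open>s\<close> through the first \<open>K\<close> of the \<open>f k\<close>, choosing \<open>K\<close> before \<open>N\<close>.\<close>
  have "norm_lim X (psum b) s"
    unfolding norm_lim_def
  proof (intro conjI LIMSEQ_I)
    fix e :: real assume e: "e > 0"
    obtain K1 where K1: "\<And>K. K \<ge> K1 \<Longrightarrow> norm (\<Sum>k. q (k + K)) < e / 4"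
      using suminf_exist_split[of "e / 4" q] sq[of 0] e by auto
    obtain K2 where K2: "\<And>K. K \<ge> K2 \<Longrightarrow> nrm ((\<Sum>k<K. f k) - s) < e / 4"
      using lim e s unfolding norm_lim_def
      by (force dest!: LIMSEQ_D[of _ 0 "e / 4"])
    define K where "K = max K1 K2"
    have "norm_lim X (\<lambda>N. \<Sum>k<K. psum (coef (f k)) N) (\<Sum>k<K. f k)"
      by (intro norm_lim_sum expand) simp
    then have "(\<lambda>N. nrm ((\<Sum>k<K. psum (coef (f k)) N) - (\<Sum>k<K. f k))) \<longlonglongrightarrow> 0"
      by (simp add: norm_lim_def)
    then obtain N0 where N0: "\<And>N. N \<ge> N0 \<Longrightarrow>
        nrm ((\<Sum>k<K. psum (coef (f k)) N) - (\<Sum>k<K. f k)) < e / 4"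
      using e by (force dest!: LIMSEQ_D[of _ 0 "e / 4"])
    have "norm (nrm (psum b N - s) - 0) < e" if N: "N \<ge> N0" for N
    proof -
      let ?S = "\<Sum>k<K. psum (coef (f k)) N" and ?F = "\<Sum>k<K. f k"
      have "nrm (psum b N - s) \<le> nrm (psum b N - ?S) + nrm (?S - s)"
        using s by (intro norm_diff_triangle) auto
      moreover have "nrm (?S - s) \<le> nrm (?S - ?F) + nrm (?F - s)"
        using s by (intro norm_diff_triangle) auto
      moreover have "nrm (psum b N - ?S) < e / 4" using tail[of N K] K1[of K] by (simp add: K_def)
      moreover have "nrm (?F - s) < e / 4" using K2[of K] by (simp add: K_def)
      ultimately show ?thesis using N0[OF N] e s by simp
    qed
    then show "\<exists>N0. \<forall>N\<ge>N0. norm (nrm (psum b N - s) - 0) < e" by blast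
  qed (use s in auto)
  then have "b n = y n s" for n
    by (rule unique) (simp add: b_def support)
  then have "coef s = b" by auto
  then show "snorm (coef s) \<le> (\<Sum>n. snorm (coef (f n)))"
    using tail[of _ 0] by (intro snorm_least) (simp add: q_def)
qed (use that in blast)

text \<open>Off \<open>J\<close> the functionals vanish; on \<open>J\<close> each is a quotient by \<open>nrm (x n)\<close> of a term that the
  supremum of the partial sums controls.\<close>

lemma coef_dual: "y n \<in> dual X"
proof -
  obtain K where K: "K \<ge> 0" "\<And>v. v \<in> carr \<Longrightarrow> snorm (coef v) \<le> K * nrm v"
    using snorm_coef_bounded by blast
  show ?thesis
  proof (cases "n \<in> J")
    case True
    then have x: "nrm (x n) > 0"
      using x_nonzero norm_pos by simp
    have "norm (y n v) \<le> 2 * K / nrm (x n) * nrm v" if "v \<in> carr" for v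
      using coeff_le_snorm[of "coef v" n] K(2)[OF that] that x by (simp add: field_simps)
    then show ?thesis unfolding mem_dual_iff by blast
  next
    case False
    then show ?thesis unfolding mem_dual_iff by (intro exI[of _ 0]) (simp add: support)
  qed
qed

end

section \<open>The space of coefficients\<close>

lemma vector_space_seq: "vector_space (\<lambda>(c::'k::field) a (n::nat). c * a n)"
  by unfold_locales (auto simp: fun_eq_iff algebra_simps)

text \<open>If some \<open>x n\<close> were 0, the \<open>n\<close>-th coefficient would not influence any partial sum and \<open>snorm\<close> would
  only be a seminorm.\<close>

locale nonzero_synthesis = synthesis X x
  for X :: "('k::{real_normed_field,banach}, 'v::ab_group_add) nvs" and x +
  assumes x_nonzero: "x n \<noteq> 0"
begin

text \<open>The norm is a parameter because the space is needed with a norm equivalent to \<open>snorm\<close>, which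
  turns the embedding below into an isometry.\<close>

definition coeff_space :: "((nat \<Rightarrow> 'k) \<Rightarrow> real) \<Rightarrow> ('k, nat \<Rightarrow> 'k) nvs" where
  "coeff_space p = \<lparr>vs_scale = (\<lambda>c a n. c * a n), vs_carrier = coeffs, vs_norm = p\<rparr>"

lemma coeff_space_simps [simp]:
  "vs_scale (coeff_space p) = (\<lambda>c a n. c * a n)"
  "vs_carrier (coeff_space p) = coeffs" "vs_norm (coeff_space p) = p"
  by (auto simp: coeff_space_def)

lemma snorm_eq_0:
  assumes "a \<in> coeffs" shows "snorm a = 0 \<longleftrightarrow> a = 0"
proof
  assume "snorm a = 0"
  then have "norm (a n) * nrm (x n) \<le> 0" for n
    using coeff_le_snorm[OF assms, of n] by simp
  moreover have "nrm (x n) > 0" for n by (intro norm_pos x_mem x_nonzero)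
  ultimately have "a n = 0" for n
    by (metis mult_le_0_iff norm_le_zero_iff not_le)
  then show "a = 0" by (simp add: fun_eq_iff)
next
  assume "a = 0"
  then show "snorm a = 0" using snorm_scale[of a 0] assms by (simp add: zero_fun_def)
qed

text \<open>Each coordinate is thus continuous for \<open>snorm\<close>, because \<open>snorm\<close> controls every single term
  and \<open>x n\<close> is not 0.\<close>

lemma coeff_small_if_snorm_small:
  assumes "e > 0"
  obtains d where "d > 0" "\<And>a. a \<in> coeffs \<Longrightarrow> snorm a < d \<Longrightarrow> norm (a n) < e"
proof
  have x: "nrm (x n) > 0" by (intro norm_pos x_mem x_nonzero)
  then show "e * nrm (x n) / 2 > 0" using assms by simp
  fix a assume "a \<in> coeffs" "snorm a < e * nrm (x n) / 2"
  then have "norm (a n) * nrm (x n) < e * nrm (x n)" using coeff_le_snorm[of a n] by simp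
  then show "norm (a n) < e" using x by simp
qed

text \<open>A Cauchy sequence converges in each coordinate, since coordinates are continuous. Its partial
  sums converge to those of the coordinatewise limit \<open>a\<close>, uniformly in their length, so \<open>psum a\<close>
  inherits the Cauchy property and \<open>a\<close> lies in \<open>coeffs\<close>.\<close>

lemma snorm_complete:
  assumes f: "\<And>k. f k \<in> coeffs"
    and Cauchy: "\<And>e. e > 0 \<Longrightarrow> \<exists>K. \<forall>m\<ge>K. \<forall>n\<ge>K. snorm (f m - f n) < e"
  obtains a where "a \<in> coeffs" "(\<lambda>k. snorm (f k - a)) \<longlonglongrightarrow> 0"
proof -
  have "Cauchy (\<lambda>k. f k n)" for n
  proof (rule CauchyI)
    fix e :: real assume "e > 0"
    then obtain d where d: "d > 0" "\<And>a. a \<in> coeffs \<Longrightarrow> snorm a < d \<Longrightarrow> norm (a n) < e"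
      using coeff_small_if_snorm_small by blast
    obtain K where "\<forall>m\<ge>K. \<forall>n\<ge>K. snorm (f m - f n) < d" using Cauchy[OF d(1)] by blast
    then have "norm (f k n - f l n) < e" if "k \<ge> K" "l \<ge> K" for k l
      using d(2)[of "f k - f l"] that f by simp
    then show "\<exists>K. \<forall>k\<ge>K. \<forall>l\<ge>K. norm (f k n - f l n) < e" by blast
  qed
  then have "\<exists>l. (\<lambda>k. f k n) \<longlonglongrightarrow> l" for n
    using Cauchy_convergent convergent_def by blast
  then obtain a where a: "\<And>n. (\<lambda>k. f k n) \<longlonglongrightarrow> a n" by metis
  have lim: "norm_lim X (\<lambda>k. psum (f k) N) (psum a N)" for N
    unfolding psum_def by (rule norm_lim_scale_sum) (use a in auto)
  have close: "\<exists>K. \<forall>k\<ge>K. \<forall>N. nrm (psum (f k) N - psum a N) \<le> e" if "e > 0" for e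
  proof -
    obtain K where K: "\<forall>m\<ge>K. \<forall>n\<ge>K. snorm (f m - f n) < e" using Cauchy[OF \<open>e > 0\<close>] by blast
    have "nrm (psum (f k) N - psum a N) \<le> e" if "k \<ge> K" for k N
    proof (rule norm_lim_le[OF norm_lim_diff[OF norm_lim_const lim]])
      have "nrm (psum (f k) N - psum (f l) N) \<le> e" if "l \<ge> K" for l
        using psum_le_snorm[of "f k - f l" N] K \<open>k \<ge> K\<close> that f by (force simp: psum_diff)
      then show "\<forall>\<^sub>F l in sequentially. nrm (psum (f k) N - psum (f l) N) \<le> e"
        by (auto simp: eventually_sequentially)
    qed simp
    then show ?thesis by blast
  qed
  have "norm_Cauchy X (psum a)"
    unfolding norm_Cauchy_def
  proof (intro conjI allI impI)
    fix e :: real assume e: "e > 0"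
    obtain K where K: "\<And>N. nrm (psum (f K) N - psum a N) \<le> e / 4" using close[of "e / 4"] e by auto
    have "norm_Cauchy X (psum (f K))" using norm_lim_imp_norm_Cauchy total_lim f by blast
    then obtain N0 where N0: "\<forall>M\<ge>N0. \<forall>N\<ge>N0. nrm (psum (f K) M - psum (f K) N) < e / 4"
      using e unfolding norm_Cauchy_def by (meson divide_pos_pos zero_less_numeral)
    have "nrm (psum a M - psum a N) < e" if "M \<ge> N0" "N \<ge> N0" for M N
    proof -
      have "nrm (psum a M - psum a N) \<le> nrm (psum a M - psum (f K) M)
          + (nrm (psum (f K) M - psum (f K) N) + nrm (psum (f K) N - psum a N))"
        using norm_diff_triangle[of "psum a M" "psum (f K) M" "psum a N"]
          norm_diff_triangle[of "psum (f K) M" "psum (f K) N" "psum a N"] by simp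
      moreover have "nrm (psum (f K) M - psum (f K) N) < e / 4" using N0 that by blast
      moreover have "nrm (psum a M - psum (f K) M) \<le> e / 4" using K norm_commute by simp
      ultimately show ?thesis using K[of N] e by linarith
    qed
    then show "\<exists>N0. \<forall>M\<ge>N0. \<forall>N\<ge>N0. nrm (psum a M - psum a N) < e" by blast
  qed auto
  then have am: "a \<in> coeffs" using norm_Cauchy_lim coeffsI by blast
  moreover have "(\<lambda>k. snorm (f k - a)) \<longlonglongrightarrow> 0"
  proof (rule LIMSEQ_I)
    fix e :: real assume e: "e > 0"
    obtain K where K: "\<And>k N. k \<ge> K \<Longrightarrow> nrm (psum (f k) N - psum a N) \<le> e / 2"
      using close[of "e / 2"] e by auto
    have "norm (snorm (f k - a) - 0) < e" if "k \<ge> K" for k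
    proof -
      have "snorm (f k - a) \<le> e / 2" by (rule snorm_least) (use K that in \<open>simp add: psum_diff\<close>)
      then show ?thesis using e snorm_nonneg[of "f k - a"] am f by simp
    qed
    then show "\<exists>K. \<forall>k\<ge>K. norm (snorm (f k - a) - 0) < e" by blast
  qed
  ultimately show thesis by (rule that)
qed

definition initial :: "(nat \<Rightarrow> 'k) \<Rightarrow> nat \<Rightarrow> nat \<Rightarrow> 'k" where
  "initial a N n = (if n < N then a n else 0)"

lemma psum_initial: "psum (initial a N) M = psum a (min M N)"
  unfolding psum_def by (rule sum.mono_neutral_cong_right) (auto simp: initial_def)

lemma initial_mem [simp]: "initial a N \<in> coeffs"
proof (rule coeffsI[OF norm_limI[OF _ _ tendsto_const]])
  show "\<forall>\<^sub>F M in sequentially. nrm (psum (initial a N) M - psum a N) \<le> 0"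
    unfolding eventually_sequentially by (rule exI[of _ N]) (simp add: psum_initial min_def)
qed auto

text \<open>The partial sums of \<open>initial a N - a\<close> are differences of partial sums of \<open>a\<close> beyond \<open>N\<close>, which are
  small because these form a Cauchy sequence.\<close>

lemma snorm_initial_tendsto:
  assumes "a \<in> coeffs"
  shows "(\<lambda>N. snorm (initial a N - a)) \<longlonglongrightarrow> 0"
proof (rule LIMSEQ_I)
  fix e :: real assume e: "e > 0"
  have "norm_Cauchy X (psum a)" using assms norm_lim_imp_norm_Cauchy total_lim by blast
  then obtain K where K: "\<forall>M\<ge>K. \<forall>N\<ge>K. nrm (psum a M - psum a N) < e / 2"
    using e unfolding norm_Cauchy_def by (meson half_gt_zero)
  have "norm (snorm (initial a N - a) - 0) < e" if N: "N \<ge> K" for N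
  proof -
    have "snorm (initial a N - a) \<le> e / 2"
    proof (rule snorm_least)
      fix M
      show "nrm (psum (initial a N - a) M) \<le> e / 2"
        using K N e by (cases "M \<le> N") (auto simp: psum_diff psum_initial less_imp_le)
    qed
    then show ?thesis using e snorm_nonneg[of "initial a N - a"] assms by simp
  qed
  then show "\<exists>K. \<forall>N\<ge>K. norm (snorm (initial a N - a) - 0) < e" by blast
qed

lemma initial_limit_unique:
  assumes "a \<in> coeffs" "(\<lambda>N. snorm (initial b N - a)) \<longlonglongrightarrow> 0"
  shows "b = a"
proof
  fix n
  have "norm (b n - a n) < e" if "e > 0" for e
  proof -
    obtain d where d: "d > 0" "\<And>a. a \<in> coeffs \<Longrightarrow> snorm a < d \<Longrightarrow> norm (a n) < e"
      using coeff_small_if_snorm_small[OF \<open>e > 0\<close>] by blast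
    obtain N where "\<forall>M\<ge>N. norm (snorm (initial b M - a) - 0) < d"
      using LIMSEQ_D[OF assms(2) d(1)] by blast
    then have "snorm (initial b (max N (Suc n)) - a) < d" by (metis abs_less_iff diff_zero max.cobounded1 real_norm_def)
    then show ?thesis using d(2)[of "initial b (max N (Suc n)) - a"] assms by (simp add: initial_def less_max_iff_disj)
  qed
  then have "norm (b n - a n) \<le> 0" by (meson dense_le_bounded linorder_not_le order_less_irrefl)
  then show "b n = a n" by simp
qed

text \<open>The unit vectors form the basis: the partial sums of their series are the initial segments
  \<open>initial a N\<close>, whose limit determines the coefficients. Both properties depend on convergent and
  Cauchy sequences only, so they pass from \<open>snorm\<close> to any equivalent norm.\<close>

lemma
  assumes Z: "normed_space (coeff_space p)"
    and le: "\<And>a. a \<in> coeffs \<Longrightarrow> snorm a \<le> B * p a" "\<And>a. a \<in> coeffs \<Longrightarrow> p a \<le> B' * snorm a"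
  shows banach_coeff_space: "banach_space (coeff_space p)"
    and basis_coeff_space: "has_schauder_basis (coeff_space p)"
proof -
  interpret Z: normed_space_on "coeff_space p" by unfold_locales (rule Z)
  have Z_lim: "norm_lim (coeff_space p) f s \<longleftrightarrow>
      range f \<subseteq> coeffs \<and> s \<in> coeffs \<and> (\<lambda>n. snorm (f n - s)) \<longlonglongrightarrow> 0" for f s
  proof -
    have "(\<lambda>n. p (f n - s)) \<longlonglongrightarrow> 0 \<longleftrightarrow> (\<lambda>n. snorm (f n - s)) \<longlonglongrightarrow> 0"
      if f: "range f \<subseteq> coeffs" "s \<in> coeffs"
    proof
      have d: "f n - s \<in> coeffs" for n using f coeffs_diff by (simp add: image_subset_iff)
      { assume *: "(\<lambda>n. p (f n - s)) \<longlonglongrightarrow> 0"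
        show "(\<lambda>n. snorm (f n - s)) \<longlonglongrightarrow> 0"
          by (rule tendsto_sandwich[OF _ _ tendsto_const tendsto_mult_right_zero[OF *, of B]])
            (use le d in auto) }
      { assume *: "(\<lambda>n. snorm (f n - s)) \<longlonglongrightarrow> 0"
        show "(\<lambda>n. p (f n - s)) \<longlonglongrightarrow> 0"
          by (rule tendsto_sandwich[OF _ _ tendsto_const tendsto_mult_right_zero[OF *, of B']])
            (use le d Z.norm_nonneg in auto) }
    qed
    then show ?thesis by (auto simp: norm_lim_def)
  qed
  show "banach_space (coeff_space p)"
    unfolding Z.banach_space_iff
  proof (intro allI impI)
    fix f assume f: "norm_Cauchy (coeff_space p) f"
    have fm: "f k \<in> coeffs" for k using f by (auto simp: norm_Cauchy_def)
    have "\<exists>K. \<forall>m\<ge>K. \<forall>n\<ge>K. snorm (f m - f n) < e" if e: "e > 0" for e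
    proof -
      have "e / (\<bar>B\<bar> + 1) > 0" using e by simp
      then obtain K where K: "\<forall>m\<ge>K. \<forall>n\<ge>K. p (f m - f n) < e / (\<bar>B\<bar> + 1)"
        using f unfolding norm_Cauchy_def by fastforce
      have "snorm (f m - f n) < e" if "m \<ge> K" "n \<ge> K" for m n
      proof -
        have "snorm (f m - f n) \<le> B * p (f m - f n)" using le fm by simp
        also have "\<dots> \<le> (\<bar>B\<bar> + 1) * p (f m - f n)"
          using Z.norm_nonneg[of "f m - f n"] fm by (intro mult_right_mono) auto
        also have "\<dots> < (\<bar>B\<bar> + 1) * (e / (\<bar>B\<bar> + 1))"
          using K that by (intro mult_strict_left_mono) auto
        finally show ?thesis by simp
      qed
      then show ?thesis by blast
    qed
    then obtain a where "a \<in> coeffs" "(\<lambda>k. snorm (f k - a)) \<longlonglongrightarrow> 0"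
      using snorm_complete[of f] fm by blast
    then show "\<exists>s. norm_lim (coeff_space p) f s" using fm by (auto simp: Z_lim)
  qed
  \<comment> \<open>Bases are indexed from 1 and coordinates from 0, so the \<open>n\<close>-th basis vector is 1 at \<open>n - 1\<close>.\<close>
  define e :: "nat \<Rightarrow> nat \<Rightarrow> 'k" where "e n m = (if Suc m = n then 1 else 0)" for n m
  have e_Suc: "e (Suc n) = initial (\<lambda>_. 1) (Suc n) - initial (\<lambda>_. 1) n" for n
    by (auto simp: e_def initial_def fun_eq_iff)
  have e: "e n \<in> coeffs" if "n \<ge> 1" for n
    using that e_Suc[of "n - 1"] by simp
  have e_sum: "(\<Sum>n<N. (\<lambda>m. b (Suc n) * e (Suc n) m)) = initial (\<lambda>n. b (Suc n)) N" for b N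
  proof (induction N)
    case (Suc N)
    show ?case
      unfolding sum.lessThan_Suc Suc by (auto simp: initial_def e_def fun_eq_iff less_Suc_eq)
  qed (auto simp: initial_def fun_eq_iff)
  have sums: "sums_on (coeff_space p) {1..} (\<lambda>n. vs_scale (coeff_space p) (b n) (e n)) a
      \<longleftrightarrow> (\<lambda>n. b (Suc n)) = a" if "a \<in> coeffs" for a b
  proof -
    have "sums_on (coeff_space p) {1..} (\<lambda>n. vs_scale (coeff_space p) (b n) (e n)) a
        \<longleftrightarrow> norm_lim (coeff_space p) (initial (\<lambda>n. b (Suc n))) a"
      using e e_sum[of b] by (subst Z.sums_on_iff) auto
    also have "\<dots> \<longleftrightarrow> (\<lambda>n. b (Suc n)) = a"
      using that initial_limit_unique snorm_initial_tendsto by (auto simp: Z_lim)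
    finally show ?thesis .
  qed
  have "schauder_basis_seq (coeff_space p) e"
    unfolding schauder_basis_seq_def
  proof (intro conjI allI impI ballI)
    fix a assume a: "a \<in> vs_carrier (coeff_space p)"
    let ?b = "\<lambda>n. if n \<ge> 1 then a (n - 1) else undefined"
    have b: "?b \<in> extensional {1..} \<and>
        sums_on (coeff_space p) {1..} (\<lambda>n. vs_scale (coeff_space p) (?b n) (e n)) a"
      using a sums[of a ?b] by (intro conjI) (auto simp: extensional_def simp del: coeff_space_simps(1))
    show "\<exists>!b. b \<in> extensional {1..} \<and>
        sums_on (coeff_space p) {1..} (\<lambda>n. vs_scale (coeff_space p) (b n) (e n)) a"
    proof (rule ex1I[of _ ?b], rule b)
      fix b assume b: "b \<in> extensional {1..} \<and>
        sums_on (coeff_space p) {1..} (\<lambda>n. vs_scale (coeff_space p) (b n) (e n)) a"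
      then have ba: "(\<lambda>n. b (Suc n)) = a" using sums a by simp
      show "b = ?b"
      proof
        fix n
        show "b n = ?b n"
          using b by (cases n) (auto simp: ba[symmetric] extensional_def)
      qed
    qed
  qed (use e in auto)
  then show "has_schauder_basis (coeff_space p)" by (auto simp: has_schauder_basis_def)
qed

end

section \<open>Embedding a space with a frame\<close>

text \<open>The bound \<open>K\<close> says that \<open>coef\<close> is a bounded map into the coefficients. As \<open>total\<close> is a left
  inverse of it, \<open>coef \<circ> total\<close> is a projection onto the range of \<open>coef\<close>.\<close>

locale nonzero_expansion = expansion X x y + nonzero_synthesis X x
  for X :: "('k::{real_normed_field,banach}, 'v::ab_group_add) nvs" and x y +
  fixes K :: real
  assumes K: "K \<ge> 0" "v \<in> carr \<Longrightarrow> snorm (coef v) \<le> K * nrm v"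
begin

text \<open>In general \<open>snorm (coef v)\<close> exceeds the norm of \<open>v\<close>, so \<open>coef\<close> is not isometric for \<open>snorm\<close>. The
  remedy is to split \<open>a\<close> along the projection \<open>coef \<circ> total\<close> and to measure the component in the
  range of \<open>coef\<close> by the norm of the vector that it represents.\<close>

definition split_norm :: "(nat \<Rightarrow> 'k) \<Rightarrow> real" where
  "split_norm a = nrm (total a) + snorm (a - coef (total a))"

lemma split_norm_coef: "v \<in> carr \<Longrightarrow> split_norm (coef v) = nrm v"
  using snorm_eq_0[of 0] by (simp add: split_norm_def)

lemma snorm_le_split_norm:
  assumes a: "a \<in> coeffs" shows "snorm a \<le> (K + 1) * split_norm a"
proof -
  have "snorm a \<le> snorm (a - coef (total a)) + snorm (coef (total a))"
    using snorm_add[of "a - coef (total a)" "coef (total a)"] a by simp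
  also have "\<dots> \<le> snorm (a - coef (total a)) + K * nrm (total a)" using K a by simp
  also have "\<dots> \<le> (K + 1) * split_norm a"
    using K(1) a by (simp add: split_norm_def algebra_simps)
  finally show ?thesis .
qed

lemma split_norm_le_snorm:
  assumes a: "a \<in> coeffs" shows "split_norm a \<le> (2 + K) * snorm a"
proof -
  have "snorm (a - coef (total a)) \<le> snorm a + snorm (coef (total a))"
    using snorm_add[of a "\<lambda>n. - 1 * coef (total a) n"] snorm_scale[of "coef (total a)" "- 1"] a
      coeffs_scale[of "coef (total a)" "-1"]
    by (simp add: plus_fun_def fun_diff_def)
  moreover have "snorm (coef (total a)) \<le> K * nrm (total a)" using K a by simp
  moreover have "K * nrm (total a) \<le> K * snorm a"
    using K(1) total_le_snorm[OF a] by (rule mult_left_mono[rotated])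
  ultimately show ?thesis using total_le_snorm[OF a] by (simp add: split_norm_def algebra_simps)
qed

lemma normed_split_norm: "normed_space (coeff_space split_norm)"
proof -
  interpret S: vector_space "\<lambda>(c::'k) a (n::nat). c * a n" by (rule vector_space_seq)
  have "S.subspace coeffs" by (rule S.subspaceI) auto
  moreover have "0 \<le> split_norm a" if "a \<in> coeffs" for a using that by (simp add: split_norm_def)
  moreover have "split_norm a = 0 \<longleftrightarrow> a = 0" if a: "a \<in> coeffs" for a
  proof
    assume "split_norm a = 0"
    then have "snorm a = 0" using snorm_le_split_norm[OF a] snorm_nonneg[OF a] by simp
    then show "a = 0" using snorm_eq_0 a by blast
  next
    assume "a = 0"
    then have "snorm a = 0" using snorm_eq_0 a by blast
    then show "split_norm a = 0" using split_norm_le_snorm[OF a] a by (simp add: split_norm_def order_antisym)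
  qed
  moreover have "split_norm (\<lambda>n. c * a n) = norm c * split_norm a" if a: "a \<in> coeffs" for a c
  proof -
    have "(\<lambda>n. c * a n) - coef (total (\<lambda>n. c * a n)) = (\<lambda>n. c * (a - coef (total a)) n)"
      using a by (simp add: total_scale y_scale fun_eq_iff algebra_simps)
    then have "snorm ((\<lambda>n. c * a n) - coef (total (\<lambda>n. c * a n))) = norm c * snorm (a - coef (total a))"
      using snorm_scale[of "a - coef (total a)" c] a by simp
    then show ?thesis using a by (simp add: split_norm_def total_scale algebra_simps)
  qed
  moreover have "split_norm (a + b) \<le> split_norm a + split_norm b"
    if a: "a \<in> coeffs" and b: "b \<in> coeffs" for a b
  proof -
    have *: "a + b - coef (total (a + b)) = (a - coef (total a)) + (b - coef (total b))"
      using a b by (simp add: total_add coef_add fun_eq_iff algebra_simps)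
    have "split_norm (a + b)
        = nrm (total a + total b) + snorm ((a - coef (total a)) + (b - coef (total b)))"
      unfolding split_norm_def * using a b by (simp add: total_add)
    then show ?thesis
      using snorm_add[of "a - coef (total a)" "b - coef (total b)"] a b
        norm_triangle[of "total a" "total b"]
      by (simp add: split_norm_def)
  qed
  ultimately show ?thesis
    unfolding normed_space_def coeff_space_simps using vector_space_seq by blast
qed

lemma complemented_embedding:
  "\<exists>Z :: ('k, nat \<Rightarrow> 'k) nvs. banach_space Z \<and> has_schauder_basis Z \<and>
     (\<exists>F. complemented Z F \<and> isometrically_isomorphic X (linear_subspace Z F))"
proof (intro exI[of _ "coeff_space split_norm"] exI[of _ "coef ` carr"] conjI)
  let ?Z = "coeff_space split_norm"
  show "banach_space ?Z" "has_schauder_basis ?Z"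
    using banach_coeff_space basis_coeff_space normed_split_norm
      snorm_le_split_norm split_norm_le_snorm by blast+
  show "complemented ?Z (coef ` carr)"
    unfolding complemented_def
  proof (intro exI[of _ "\<lambda>a. coef (total a)"] conjI)
    show "bounded_linear_map ?Z ?Z (\<lambda>a. coef (total a))"
      unfolding bounded_linear_map_def linear_map_def
      by (auto simp: total_add total_scale coef_add coef_scale split_norm_coef intro!: exI[of _ 1])
        (auto simp: split_norm_def)
    have "v \<in> (\<lambda>a. coef (total a)) ` coeffs" if "v \<in> coef ` carr" for v
      using that by (auto intro!: image_eqI[of _ _ v])
    then show "(\<lambda>a. coef (total a)) ` vs_carrier ?Z = coef ` carr" by auto
  qed auto
  show "isometrically_isomorphic X (linear_subspace ?Z (coef ` carr))"
    unfolding isometrically_isomorphic_def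
  proof (intro exI[of _ coef] conjI)
    have "inj_on coef carr" by (rule inj_on_inverseI[of _ total]) simp
    then show "bij_betw coef carr (vs_carrier (linear_subspace ?Z (coef ` carr)))"
      by (simp add: bij_betw_def linear_subspace_def)
  qed (auto simp: linear_map_def linear_subspace_def coef_add coef_scale split_norm_coef)
qed

end

text \<open>The frame is brought to the form of \<open>nonzero_expansion\<close>: where the index is missing from \<open>I\<close> or
  the frame vector is 0, the pair is replaced by \<open>u\<close> with the zero functional, which contributes
  nothing to any partial sum. Indices are shifted to start at 0.\<close>

lemma frame_embedding_if_nonzero:
  fixes E :: "('k::{real_normed_field,banach}, 'v::ab_group_add) nvs"
  assumes "banach_space E" "has_schauder_frame E" and u: "u \<in> vs_carrier E" "u \<noteq> 0"
  shows "\<exists>Z :: ('k, nat \<Rightarrow> 'k) nvs. banach_space Z \<and> has_schauder_basis Z \<and>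
     (\<exists>F. complemented Z F \<and> isometrically_isomorphic E (linear_subspace Z F))"
proof -
  interpret E: banach_space_on E by unfold_locales fact
  obtain I x y where I: "index_set I"
    and mem: "\<And>n. n \<in> I \<Longrightarrow> x n \<in> vs_carrier E" "\<And>n. n \<in> I \<Longrightarrow> y n \<in> dual E"
    and exp: "\<And>v. v \<in> vs_carrier E \<Longrightarrow> sums_on E I (\<lambda>n. vs_scale E (y n v) (x n)) v"
    using assms(2) unfolding has_schauder_frame_def schauder_frame_def by blast
  define good where "good n \<longleftrightarrow> Suc n \<in> I \<and> x (Suc n) \<noteq> 0" for n
  define x' where "x' n = (if good n then x (Suc n) else u)" for n
  define y' where "y' n = (if good n then y (Suc n) else (\<lambda>_. 0))" for n
  have lin: "y n (v + w) = y n v + y n w" "y n (vs_scale E c v) = c * y n v"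
    if "n \<in> I" "v \<in> vs_carrier E" "w \<in> vs_carrier E" for n v w c
    using mem(2)[OF that(1)] that
    by (auto simp: dual_def bounded_linear_map_def linear_map_def scalar_space_def)
  interpret E: synthesis E x'
    by unfold_locales (auto simp: x'_def good_def mem u)
  have sum_eq: "(\<Sum>n\<in>{n\<in>I. n \<le> N}. vs_scale E (y n v) (x n)) = E.psum (\<lambda>n. y' n v) N" for v N
  proof -
    have "(\<Sum>n\<in>{n\<in>I. n \<le> N}. vs_scale E (y n v) (x n))
        = (\<Sum>n\<in>{n\<in>I. n \<le> N \<and> x n \<noteq> 0}. vs_scale E (y n v) (x n))"
    proof (rule sum.mono_neutral_right)
      show "finite {n \<in> I. n \<le> N}" by (rule finite_subset[of _ "{..N}"]) auto
    qed auto
    also have "\<dots> = (\<Sum>n\<in>{n. n < N \<and> good n}. vs_scale E (y (Suc n) v) (x (Suc n)))"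
      using I by (intro sum.reindex_bij_witness[of _ Suc "\<lambda>n. n - 1"])
        (auto simp: good_def index_set_def)
    also have "\<dots> = (\<Sum>n\<in>{n. n < N \<and> good n}. vs_scale E (y' n v) (x' n))"
      by (rule sum.cong) (auto simp: x'_def y'_def)
    also have "\<dots> = E.psum (\<lambda>n. y' n v) N"
      unfolding E.psum_def by (rule sum.mono_neutral_left) (auto simp: y'_def)
    finally show ?thesis .
  qed
  interpret E: expansion E x' y'
  proof
    show "norm_lim E (E.psum (\<lambda>n. y' n v)) v" if "v \<in> vs_carrier E" for v
      using exp[OF that] E.limitin_iff_norm_lim[of "E.psum (\<lambda>n. y' n v)" v]
      by (simp add: sums_on_def sum_eq image_subset_iff)
  qed (auto simp: y'_def good_def lin)
  have "y' n \<in> dual E" for n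
  proof (cases "good n")
    case True
    then show ?thesis by (simp add: y'_def good_def mem)
  next
    case False
    then show ?thesis unfolding E.mem_dual_iff by (auto simp: y'_def intro!: exI[of _ 0])
  qed
  then obtain K where K: "K \<ge> 0"
      "\<And>v. v \<in> vs_carrier E \<Longrightarrow> E.snorm (\<lambda>n. y' n v) \<le> K * vs_norm E v"
    using E.snorm_coef_bounded_if_dual by blast
  interpret E: nonzero_expansion E x' y' K
    by unfold_locales (use K u in \<open>auto simp: x'_def good_def\<close>)
  show ?thesis by (rule E.complemented_embedding)
qed

text \<open>The zero space has no nonzero vector to fill the gaps of a frame with, but it is isometric to the
  zero space of sequences.\<close>

lemma trivial_space_embedding:
  fixes E :: "('k::{real_normed_field,banach}, 'v::ab_group_add) nvs"
  assumes "banach_space E" and E: "vs_carrier E = {0}"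
  shows "\<exists>Z :: ('k, nat \<Rightarrow> 'k) nvs. banach_space Z \<and> has_schauder_basis Z \<and>
     (\<exists>F. complemented Z F \<and> isometrically_isomorphic E (linear_subspace Z F))"
proof -
  interpret E: banach_space_on E by unfold_locales fact
  interpret S: vector_space "\<lambda>(c::'k) a (n::nat). c * a n" by (rule vector_space_seq)
  define Z :: "('k, nat \<Rightarrow> 'k) nvs"
    where "Z = \<lparr>vs_scale = (\<lambda>c a n. c * a n), vs_carrier = {0}, vs_norm = (\<lambda>_. 0)\<rparr>"
  have [simp]: "vs_scale Z = (\<lambda>c a n. c * a n)" "vs_carrier Z = {0}" "vs_norm Z = (\<lambda>_. 0)"
    by (auto simp: Z_def)
  have "normed_space Z"
    using vector_space_seq S.subspace_single_0 by (simp add: normed_space_def zero_fun_def)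
  then interpret Z: normed_space_on Z by unfold_locales
  have "norm_lim Z f 0" if "norm_Cauchy Z f" for f
    using that by (auto simp: norm_lim_def norm_Cauchy_def)
  then have "banach_space Z" unfolding Z.banach_space_iff by blast
  moreover have "has_schauder_basis Z"
    unfolding has_schauder_basis_def
    by (rule disjI2) (auto intro!: exI[of _ "{}"] S.independent_empty)
  moreover have "complemented Z {0}"
    unfolding complemented_def bounded_linear_map_def linear_map_def
    by (auto intro!: exI[of _ "\<lambda>a. a"] simp: zero_fun_def)
  moreover have "isometrically_isomorphic E (linear_subspace Z {0})"
    unfolding isometrically_isomorphic_def
  proof (intro exI[of _ "\<lambda>_. 0"] conjI)
    show "bij_betw (\<lambda>_. 0) (vs_carrier E) (vs_carrier (linear_subspace Z {0}))"
      unfolding E by (simp add: bij_betw_def linear_subspace_def)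
    show "\<forall>v\<in>vs_carrier E. vs_norm (linear_subspace Z {0}) 0 = vs_norm E v"
      unfolding E by (simp add: linear_subspace_def)
    show "linear_map E (linear_subspace Z {0}) (\<lambda>_. 0)"
      by (simp add: linear_map_def linear_subspace_def image_subset_iff) (simp add: zero_fun_def)
  qed
  ultimately show ?thesis by (intro exI[of _ Z] exI[of _ "{0}"] conjI)
qed

lemma frame_imp_complemented_in_basis_space:
  fixes E :: "('k::{real_normed_field,banach}, 'v::ab_group_add) nvs"
  assumes "banach_space E" "has_schauder_frame E"
  shows "\<exists>Z :: ('k, nat \<Rightarrow> 'k) nvs. banach_space Z \<and> has_schauder_basis Z \<and>
     (\<exists>F. complemented Z F \<and> isometrically_isomorphic E (linear_subspace Z F))"
proof (cases "vs_carrier E = {0}")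
  case True
  with assms(1) show ?thesis by (rule trivial_space_embedding)
next
  case False
  interpret E: banach_space_on E by unfold_locales (rule assms(1))
  obtain u where "u \<in> vs_carrier E" "u \<noteq> 0" using False E.zero_mem by blast
  with assms show ?thesis by (rule frame_embedding_if_nonzero)
qed

section \<open>Complemented subspaces of spaces with a basis\<close>

lemma linear_map_sum:
  assumes "normed_space X" "normed_space Y" "linear_map X Y T"
    and "\<And>i. i \<in> A \<Longrightarrow> x i \<in> vs_carrier X"
  shows "T (\<Sum>i\<in>A. vs_scale X (c i) (x i)) = (\<Sum>i\<in>A. vs_scale Y (c i) (T (x i)))"
proof -
  interpret X: normed_space_on X by unfold_locales fact
  have T: "T (u + v) = T u + T v" "T (vs_scale X a u) = vs_scale Y a (T u)"
    if "u \<in> vs_carrier X" "v \<in> vs_carrier X" for u v a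
    using assms(3) that by (auto simp: linear_map_def)
  have "T 0 = 0" using T(1)[of 0 0] by simp
  moreover note T(1) T(2)[OF _ X.zero_mem]
  ultimately show ?thesis using assms(4)
    by (induction A rule: infinite_finite_induct) auto
qed

lemma bounded_linear_map_norm_lim:
  assumes "normed_space X" "normed_space Y" "bounded_linear_map X Y T" "norm_lim X f s"
  shows "norm_lim Y (\<lambda>n. T (f n)) (T s)"
proof -
  interpret X: normed_space_on X by unfold_locales fact
  interpret Y: normed_space_on Y by unfold_locales fact
  note m = X.norm_lim_mem[OF assms(4)]
  have lin: "linear_map X Y T" using assms(3) by (simp add: bounded_linear_map_def)
  then have mem: "T v \<in> vs_carrier Y" if "v \<in> vs_carrier X" for v
    using that by (auto simp: linear_map_def)
  have T_diff: "T (f n - s) = T (f n) - T s" for n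
  proof -
    have "T (f n - s + s) = T (f n - s) + T s"
      using lin m unfolding linear_map_def by (meson X.diff_mem)
    then show ?thesis by simp
  qed
  obtain C where C: "\<And>v. v \<in> vs_carrier X \<Longrightarrow> vs_norm Y (T v) \<le> C * vs_norm X v"
    using assms(3) by (auto simp: bounded_linear_map_def)
  show ?thesis
  proof (rule Y.norm_limI)
    show "(\<lambda>n. C * vs_norm X (f n - s)) \<longlonglongrightarrow> 0"
      using assms(4) by (intro tendsto_mult_right_zero) (simp add: norm_lim_def)
    show "\<forall>\<^sub>F n in sequentially. vs_norm Y (T (f n) - T s) \<le> C * vs_norm X (f n - s)"
      using C m by (simp add: T_diff[symmetric])
  qed (use mem m in auto)
qed

lemma continuous_map_norm_lim:
  assumes "normed_space X" "normed_space Y"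
    and T: "continuous_map (vs_topology X) (vs_topology Y) T" and f: "norm_lim X f s"
  shows "norm_lim Y (\<lambda>n. T (f n)) (T s)"
proof -
  interpret X: normed_space_on X by unfold_locales fact
  interpret Y: normed_space_on Y by unfold_locales fact
  have "limitin (vs_topology X) f s sequentially"
    using f X.limitin_iff_norm_lim by (auto simp: norm_lim_def)
  then have "limitin (vs_topology Y) (T \<circ> f) (T s) sequentially"
    by (rule continuous_map_limit[OF T])
  moreover have "T v \<in> vs_carrier Y" if "v \<in> vs_carrier X" for v
    using continuous_map_funspace[OF T] that by (auto simp: vs_topology_def)
  then have "range (T \<circ> f) \<subseteq> vs_carrier Y" using f by (auto simp: norm_lim_def)
  ultimately show ?thesis using Y.limitin_iff_norm_lim by (simp add: o_def)
qed

text \<open>For continuous \<open>T\<close> the seminorm \<open>vs_norm Y (T v)\<close> is countably subadditive, because \<open>T\<close> can be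
  applied to a convergent series term by term.\<close>

lemma continuous_linear_map_bounded:
  assumes "banach_space X" "normed_space Y" "linear_map X Y T"
    and T: "continuous_map (vs_topology X) (vs_topology Y) T"
  shows "bounded_linear_map X Y T"
proof -
  interpret X: banach_space_on X by unfold_locales fact
  interpret Y: normed_space_on Y by unfold_locales fact
  have mem: "T v \<in> vs_carrier Y" if "v \<in> vs_carrier X" for v
    using that assms(3) by (auto simp: linear_map_def)
  obtain K where "\<And>v. v \<in> vs_carrier X \<Longrightarrow> vs_norm Y (T v) \<le> K * vs_norm X v"
  proof (rule X.countably_subadditive_seminorm_bounded[of "\<lambda>v. vs_norm Y (T v)"])
    show "vs_norm Y (T (vs_scale X c v)) = norm c * vs_norm Y (T v)" if "v \<in> vs_carrier X" for c v
      using that assms(3) mem by (simp add: linear_map_def)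
    show "vs_norm Y (T (u + v)) \<le> vs_norm Y (T u) + vs_norm Y (T v)"
      if "u \<in> vs_carrier X" "v \<in> vs_carrier X" for u v
      using that assms(3) mem Y.norm_triangle by (simp add: linear_map_def)
    fix f s
    assume lim: "norm_lim X (\<lambda>N. \<Sum>n<N. f n) s" and f: "range f \<subseteq> vs_carrier X"
      and sm: "summable (\<lambda>n. vs_norm Y (T (f n)))"
    have fm [simp]: "f n \<in> vs_carrier X" for n using f by auto
    show "vs_norm Y (T s) \<le> (\<Sum>n. vs_norm Y (T (f n)))"
    proof (rule Y.norm_lim_le[OF continuous_map_norm_lim[OF X.normed Y.normed T lim]],
        intro always_eventually allI)
      fix N
      have "T (\<Sum>n<N. f n) = (\<Sum>n<N. T (f n))"
        using linear_map_sum[OF X.normed Y.normed assms(3), of "{..<N}" f "\<lambda>_. 1"] by simp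
      then have "vs_norm Y (T (\<Sum>n<N. f n)) \<le> (\<Sum>n<N. vs_norm Y (T (f n)))"
        using Y.norm_sum_le[of "{..<N}" "\<lambda>n. T (f n)"] mem by simp
      also have "\<dots> \<le> (\<Sum>n. vs_norm Y (T (f n)))" by (intro sum_le_suminf sm) (auto simp: mem)
      finally show "vs_norm Y (T (\<Sum>n<N. f n)) \<le> (\<Sum>n. vs_norm Y (T (f n)))" .
    qed
  qed (use mem in auto)
  then show ?thesis using assms(3) by (auto simp: bounded_linear_map_def)
qed

lemma schauder_basis_unique_expansion:
  fixes Z :: "('k::{real_normed_field,banach}, 'v::ab_group_add) nvs"
  assumes "banach_space Z" "schauder_basis_seq Z e"
  shows "\<exists>y. unique_expansion Z (\<lambda>n. e (Suc n)) y UNIV"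
proof -
  interpret Z: banach_space_on Z by unfold_locales fact
  have e: "e n \<in> vs_carrier Z" if "n \<ge> 1" for n
    using assms(2) that by (simp add: schauder_basis_seq_def)
  interpret Z: synthesis Z "\<lambda>n. e (Suc n)" by unfold_locales (simp add: e)
  let ?S = "\<lambda>a v. a \<in> extensional {1..} \<and> sums_on Z {1..} (\<lambda>n. vs_scale Z (a n) (e n)) v"
  have S: "sums_on Z {1..} (\<lambda>n. vs_scale Z (a n) (e n)) v
      \<longleftrightarrow> norm_lim Z (Z.psum (\<lambda>n. a (Suc n))) v" for a v
    using Z.sums_on_iff[of "\<lambda>n. vs_scale Z (a n) (e n)" v] e by (simp add: Z.psum_def[abs_def])
  have ex1: "\<exists>!a. ?S a v" if "v \<in> vs_carrier Z" for v
    using assms(2) that by (simp add: schauder_basis_seq_def)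
  define c where "c v = (THE a. ?S a v)" for v
  have c: "?S (c v) v" if "v \<in> vs_carrier Z" for v
    unfolding c_def by (rule theI'[OF ex1[OF that]])
  have "unique_expansion Z (\<lambda>n. e (Suc n)) (\<lambda>n v. c v (Suc n)) UNIV"
  proof
    show "norm_lim Z (Z.psum (\<lambda>n. c v (Suc n))) v" if "v \<in> vs_carrier Z" for v
      using c[OF that] S by blast
    fix b v n assume b: "norm_lim Z (Z.psum b) v"
    then have v: "v \<in> vs_carrier Z" using Z.norm_lim_mem by blast
    define a where "a n = (if n \<ge> 1 then b (n - 1) else undefined)" for n
    have "(\<lambda>n. a (Suc n)) = b" by (simp add: a_def)
    then have "sums_on Z {1..} (\<lambda>n. vs_scale Z (a n) (e n)) v" using b S[of a v] by simp
    then have "?S a v" by (simp add: a_def extensional_def)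
    then have "a = c v" using ex1[OF v] c[OF v] by blast
    from fun_cong[OF this, of "Suc n"] show "b n = c v (Suc n)" by (simp add: a_def)
  qed auto
  then show ?thesis by blast
qed

text \<open>The partial sums are constant from \<open>card B\<close> on, so convergence is equality of a finite sum and
  uniqueness is linear independence.\<close>

lemma finite_basis_unique_expansion:
  fixes Z :: "('k::{real_normed_field,banach}, 'v::ab_group_add) nvs"
  assumes "banach_space Z" and B: "finite B" "\<not> module.dependent (vs_scale Z) B"
    "module.span (vs_scale Z) B = vs_carrier Z"
  shows "\<exists>x y. unique_expansion Z x y {..<card B}"
proof -
  interpret Z: banach_space_on Z by unfold_locales fact
  obtain h where h: "bij_betw h {..<card B} B"
    using ex_bij_betw_nat_finite[OF B(1)] by (auto simp: atLeast0LessThan)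
  define x where "x n = (if n < card B then h n else 0)" for n
  define y where "y n v = (if n < card B then Z.vs.representation B v (h n) else 0)" for n v
  have hB: "h n \<in> B" if "n < card B" for n using h that by (auto simp: bij_betw_def)
  interpret Z: synthesis Z x
    by unfold_locales (use hB Z.vs.span_base B(3) in \<open>auto simp: x_def\<close>)
  have psum: "Z.psum (\<lambda>n. if n < card B then g (h n) else 0) N = (\<Sum>w\<in>B. vs_scale Z (g w) w)"
    if "N \<ge> card B" for g N
  proof -
    have "Z.psum (\<lambda>n. if n < card B then g (h n) else 0) N
        = (\<Sum>n<card B. vs_scale Z (g (h n)) (h n))"
      unfolding Z.psum_def by (rule sum.mono_neutral_cong_right) (use that in \<open>auto simp: x_def\<close>)
    then show ?thesis using sum.reindex_bij_betw[OF h, of "\<lambda>w. vs_scale Z (g w) w"] by simp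
  qed
  have rep: "(\<Sum>w\<in>B. vs_scale Z (Z.vs.representation B v w) w) = v" if "v \<in> vs_carrier Z" for v
    using Z.vs.sum_representation_eq[of B v B] B that by simp
  have lim: "norm_lim Z (Z.psum (\<lambda>n. if n < card B then g (h n) else 0)) (\<Sum>w\<in>B. vs_scale Z (g w) w)"
    for g
  proof (rule Z.norm_limI[OF _ _ tendsto_const])
    show "(\<Sum>w\<in>B. vs_scale Z (g w) w) \<in> vs_carrier Z"
      using psum[of "card B" g] Z.psum_mem by (metis order_refl)
    show "\<forall>\<^sub>F N in sequentially. vs_norm Z (Z.psum (\<lambda>n. if n < card B then g (h n) else 0) N
        - (\<Sum>w\<in>B. vs_scale Z (g w) w)) \<le> 0"
      unfolding eventually_sequentially by (rule exI[of _ "card B"]) (simp add: psum)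
  qed simp
  have "unique_expansion Z x y {..<card B}"
  proof
    show "norm_lim Z (Z.psum (\<lambda>n. y n v)) v" if "v \<in> vs_carrier Z" for v
      using lim[of "Z.vs.representation B v"] rep[OF that] by (simp add: y_def)
    fix b v n
    assume b: "norm_lim Z (Z.psum b) v" and supp: "\<And>n. n \<notin> {..<card B} \<Longrightarrow> b n = 0"
    then have v: "v \<in> vs_carrier Z" using Z.norm_lim_mem by blast
    define g where "g w = b (inv_into {..<card B} h w)" for w
    have gh: "g (h n) = b n" if "n < card B" for n
      unfolding g_def using bij_betw_inv_into_left[OF h] that by simp
    have "(\<lambda>n. if n < card B then g (h n) else 0) = b"
      using gh supp by (auto simp: fun_eq_iff)
    then have "(\<Sum>w\<in>B. vs_scale Z (g w) w) = v"
      using lim[of g] b Z.norm_lim_unique by auto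
    then have "(\<Sum>w\<in>B. vs_scale Z (g w - Z.vs.representation B v w) w) = 0"
      using rep[OF v] by (simp add: Z.vs.scale_left_diff_distrib sum_subtractf)
    then have "g w = Z.vs.representation B v w" if "w \<in> B" for w
      using Z.vs.independentD[OF B(2,1) order_refl, of "\<lambda>w. g w - Z.vs.representation B v w" w] that
      by simp
    then show "b n = y n v" using gh[of n] hB[of n] supp[of n] by (auto simp: y_def)
  qed (auto simp: y_def)
  then show ?thesis by blast
qed

lemma has_schauder_basis_unique_expansion:
  fixes Z :: "('k::{real_normed_field,banach}, 'v::ab_group_add) nvs"
  assumes "banach_space Z" "has_schauder_basis Z"
  shows "\<exists>x y J. unique_expansion Z x y J"
  using assms(2) unfolding has_schauder_basis_def
proof (elim disjE exE conjE)
  fix e assume "schauder_basis_seq Z e"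
  from schauder_basis_unique_expansion[OF assms(1) this] show ?thesis by blast
next
  fix B assume "finite B" "\<not> module.dependent (vs_scale Z) B"
    "module.span (vs_scale Z) B = vs_carrier Z"
  from finite_basis_unique_expansion[OF assms(1) this] show ?thesis by blast
qed

text \<open>A frame is the image of a basis under the projection \<open>P\<close> followed by the isomorphism \<open>G\<close> from the
  range of \<open>P\<close> to \<open>E\<close>; the functionals are the coefficient functionals of the basis composed with
  the inverse \<open>T\<close> of \<open>G\<close>. Applying \<open>G \<circ> P\<close> to the expansion of \<open>T v\<close> in the basis expands \<open>v\<close>.\<close>

lemma complemented_in_basis_space_imp_frame:
  fixes E :: "('k::{real_normed_field,banach}, 'v::ab_group_add) nvs"
    and Z :: "('k, 'w::ab_group_add) nvs"
  assumes "banach_space E" "banach_space Z" "has_schauder_basis Z"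
    and "complemented Z F" "isomorphic E (linear_subspace Z F)"
  shows "has_schauder_frame E"
proof -
  obtain x y J where "unique_expansion Z x y J"
    using has_schauder_basis_unique_expansion assms by blast
  then interpret Z: unique_expansion Z x y J .
  interpret E: banach_space_on E by unfold_locales fact
  let ?L = "linear_subspace Z F"
  have [simp]: "vs_scale ?L = vs_scale Z" "vs_carrier ?L = F" "vs_norm ?L = vs_norm Z"
    by (auto simp: linear_subspace_def)
  obtain P where P: "bounded_linear_map Z Z P" "P ` vs_carrier Z = F"
      "\<And>z. z \<in> vs_carrier Z \<Longrightarrow> P (P z) = P z"
    using assms(4) by (auto simp: complemented_def)
  then have Pl: "linear_map Z Z P" by (simp add: bounded_linear_map_def)
  have F: "F \<subseteq> vs_carrier Z" using P(2) Pl by (auto simp: linear_map_def)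
  have PF: "P z = z" if "z \<in> F" for z using that P by auto
  have "Z.vs.subspace F"
  proof (rule Z.vs.subspaceI)
    show "0 \<in> F" using linear_map_sum[OF Z.normed Z.normed Pl, of "{}"] P(2) Z.zero_mem by force
    show "u + v \<in> F" if "u \<in> F" "v \<in> F" for u v
    proof -
      have "P (u + v) = u + v" using that F Pl PF by (auto simp: linear_map_def subset_iff)
      then show ?thesis using that F P(2) Z.add_mem by (metis imageI subset_iff)
    qed
    show "vs_scale Z c u \<in> F" if "u \<in> F" for c u
    proof -
      have "P (vs_scale Z c u) = vs_scale Z c u" using that F Pl PF by (auto simp: linear_map_def subset_iff)
      then show ?thesis using that F P(2) Z.scale_mem by (metis imageI subset_iff)
    qed
  qed
  then have L: "normed_space ?L"
    using Z.normed F by (auto simp: normed_space_def subset_iff)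
  interpret L: normed_space_on ?L by unfold_locales (rule L)
  have top: "topspace (vs_topology ?L) = F" "topspace (vs_topology E) = vs_carrier E"
    using L.ms.topspace_mtopology E.ms.topspace_mtopology by (simp_all add: vs_topology_def)
  obtain T where T: "linear_map E ?L T"
      and "homeomorphic_map (vs_topology E) (vs_topology ?L) T"
    using assms(5) by (auto simp: isomorphic_def)
  then obtain G where "homeomorphic_maps (vs_topology E) (vs_topology ?L) T G"
    using homeomorphic_map_maps by blast
  then have Tc: "continuous_map (vs_topology E) (vs_topology ?L) T"
    and Gc: "continuous_map (vs_topology ?L) (vs_topology E) G"
    and GT: "\<And>v. v \<in> vs_carrier E \<Longrightarrow> G (T v) = v" and TG: "\<And>z. z \<in> F \<Longrightarrow> T (G z) = z"
    by (auto simp: homeomorphic_maps_def top)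
  have TF: "T v \<in> F" if "v \<in> vs_carrier E" for v using T that by (auto simp: linear_map_def)
  have GE: "G z \<in> vs_carrier E" if "z \<in> F" for z
    using continuous_map_funspace[OF Gc] that by (auto simp: top)
  have G: "linear_map ?L E G"
    unfolding linear_map_def
  proof (intro conjI ballI allI)
    fix u v c assume u: "u \<in> vs_carrier ?L"
    { assume v: "v \<in> vs_carrier ?L"
      have "T (G u + G v) = u + v" using u v T TG GE by (simp add: linear_map_def)
      then show "G (u + v) = G u + G v" using GT[of "G u + G v"] GE u v by simp }
    have "T (vs_scale E c (G u)) = vs_scale Z c u" using u T TG GE by (simp add: linear_map_def)
    then show "G (vs_scale ?L c u) = vs_scale E c (G u)" using GT[of "vs_scale E c (G u)"] GE u by simp
  qed (use GE in auto)
  obtain D where D: "\<And>v. v \<in> vs_carrier E \<Longrightarrow> vs_norm Z (T v) \<le> D * vs_norm E v"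
    using continuous_linear_map_bounded[OF assms(1) L T Tc] by (auto simp: bounded_linear_map_def)
  have Px: "P (x n) \<in> F" for n using P(2) by auto
  have dual: "(\<lambda>v. y n (T v)) \<in> dual E" for n
  proof -
    have yT: "y n (T (u + v)) = y n (T u) + y n (T v)" "y n (T (vs_scale E c u)) = c * y n (T u)"
      if "u \<in> vs_carrier E" "v \<in> vs_carrier E" for u v c
      using T TF F that Z.y_add Z.y_scale by (auto simp: linear_map_def subset_iff)
    obtain C where C: "\<forall>z\<in>vs_carrier Z. norm (y n z) \<le> C * vs_norm Z z"
      using Z.coef_dual unfolding Z.mem_dual_iff by blast
    have "norm (y n (T v)) \<le> \<bar>C\<bar> * D * vs_norm E v" if v: "v \<in> vs_carrier E" for v
    proof -
      have Tv: "T v \<in> vs_carrier Z" using TF F v by auto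
      have "norm (y n (T v)) \<le> C * vs_norm Z (T v)" using C Tv by blast
      also have "\<dots> \<le> \<bar>C\<bar> * vs_norm Z (T v)" using Tv by (intro mult_right_mono) auto
      also have "\<dots> \<le> \<bar>C\<bar> * (D * vs_norm E v)" using D v by (intro mult_left_mono) auto
      finally show ?thesis by (simp add: mult.assoc)
    qed
    then show ?thesis
      unfolding dual_def bounded_linear_map_def linear_map_def scalar_space_def using yT by auto
  qed
  have expand: "norm_lim E (\<lambda>N. \<Sum>n<N. vs_scale E (y n (T v)) (G (P (x n)))) v"
    if v: "v \<in> vs_carrier E" for v
  proof -
    have z: "T v \<in> F" "T v \<in> vs_carrier Z" using TF F v by auto
    have "norm_lim Z (\<lambda>N. P (Z.psum (\<lambda>n. y n (T v)) N)) (P (T v))"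
      by (rule bounded_linear_map_norm_lim[OF Z.normed Z.normed P(1) Z.expand[OF z(2)]])
    moreover have "P (Z.psum (\<lambda>n. y n (T v)) N) \<in> F" for N
      unfolding P(2)[symmetric] by (rule imageI) simp
    ultimately have "norm_lim ?L (\<lambda>N. P (Z.psum (\<lambda>n. y n (T v)) N)) (T v)"
      using z(1) by (simp add: norm_lim_def PF[OF z(1)] image_subset_iff)
    then have "norm_lim E (\<lambda>N. G (P (Z.psum (\<lambda>n. y n (T v)) N))) (G (T v))"
      by (rule continuous_map_norm_lim[OF L E.normed Gc])
    moreover have "G (P (Z.psum (\<lambda>n. y n (T v)) N))
        = (\<Sum>n<N. vs_scale E (y n (T v)) (G (P (x n))))" for N
      using linear_map_sum[OF L E.normed G, of "{..<N}" "\<lambda>n. P (x n)" "\<lambda>n. y n (T v)"] Px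
        linear_map_sum[OF Z.normed Z.normed Pl, of "{..<N}" x "\<lambda>n. y n (T v)"]
      by (simp add: Z.psum_def)
    ultimately show ?thesis using GT v by simp
  qed
  have "schauder_frame E {1..} (\<lambda>n. G (P (x (n - 1)))) (\<lambda>n v. y (n - 1) (T v))"
    unfolding schauder_frame_def
  proof (intro conjI ballI)
    show "sums_on E {1..} (\<lambda>n. vs_scale E (y (n - 1) (T v)) (G (P (x (n - 1))))) v"
      if "v \<in> vs_carrier E" for v
      by (subst E.sums_on_iff) (use expand[OF that] Px GE in auto)
  qed (use dual Px GE in \<open>auto simp: index_set_def\<close>)
  then show ?thesis unfolding has_schauder_frame_def by (intro exI)
qed

theorem theorem5p1:
  shows
   "(\<forall>E :: (real, 'a::ab_group_add) nvs. banach_space E \<and> separable_space (vs_topology E) \<longrightarrow>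
       (has_schauder_frame E \<longrightarrow>
          (\<exists>Z :: (real, nat \<Rightarrow> real) nvs. banach_space Z \<and> has_schauder_basis Z \<and>
             (\<exists>F. complemented Z F \<and> isometrically_isomorphic E (linear_subspace Z F)))) \<and>
       (\<forall>Z :: (real, 'b::ab_group_add) nvs. banach_space Z \<and> has_schauder_basis Z \<and>
             (\<exists>F. complemented Z F \<and> isomorphic E (linear_subspace Z F)) \<longrightarrow>
          has_schauder_frame E))
    \<and>
    (\<forall>E :: (complex, 'c::ab_group_add) nvs. banach_space E \<and> separable_space (vs_topology E) \<longrightarrow>
       (has_schauder_frame E \<longrightarrow>
          (\<exists>Z :: (complex, nat \<Rightarrow> complex) nvs. banach_space Z \<and> has_schauder_basis Z \<and>
             (\<exists>F. complemented Z F \<and> isometrically_isomorphic E (linear_subspace Z F)))) \<and>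
       (\<forall>Z :: (complex, 'd::ab_group_add) nvs. banach_space Z \<and> has_schauder_basis Z \<and>
             (\<exists>F. complemented Z F \<and> isomorphic E (linear_subspace Z F)) \<longrightarrow>
          has_schauder_frame E))"
  by (intro conjI allI impI frame_imp_complemented_in_basis_space)
    (auto intro: complemented_in_basis_space_imp_frame)

end
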